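(* Let $1\le p<\infty$. Assume that the metric measure space $X=(X,d,\mu)$ is locally compact and that every Borel $p$-path open set in $X$ is quasiopen. Let $u:U\to[-\infty,\infty]$ be a Borel function on a quasiopen set $U\subset X$. Then the following are equivalent: (a) $u$ is quasicontinuous (with respect to $C_p$ or $C_p^U$); (b) $u$ is finite q.e. and $u\circ\gamma$ is continuous (on the set $\gamma^{-1}(U)$ where it is defined) for $p$-a.e. curve $\gamma:[0,l_\gamma]\to X$; (c) $u$ is finite q.e. and $u\circ\gamma$ is continuous for $p$-a.e. curve $\gamma:[0,l_\gamma]\to U$.
   Context: Setting: $1\le p<\infty$, and $X=(X,d,\mu)$ is a metric space with metric $d$ and a positive complete Borel measure $\mu$ such that $\mu(B)<\infty$ for all open balls $B\subset X$. Curves: a curve is a continuous mapping from an interval. Only compact rectifiable curves are considered; they are nonconstant unless otherwise stated and parameterized by arc length $ds$, so $\gamma:[0,l_\gamma]\to X$ with $l_\gamma$ the length of $\gamma$. A property holds for $p$-almost every ($p$-a.e.) curve if it fails only for a curve family $\Gamma$ for which there is a nonnegative Borel function $\rho\in L^p(X)$ with $\int_\gamma\rho\,ds=\infty$ for every $\gamma\in\Gamma$. "For $p$-a.e. curve $\gamma:[0,l_\gamma]\to U$" means that the property may fail only for such an exceptional family of curves lying in $U$. Upper gradients: a nonnegative Borel function $g$ on $X$ is an upper gradient of $f:X\to[-\infty,\infty]$ if $|f(\gamma(0))-f(\gamma(l_\gamma))|\le\int_\gamma g\,ds$ for all nonconstant compact rectifiable curves $\gamma:[0,l_\gamma]\to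 X$, where the left-hand side is $\infty$ whenever at least one of its terms is infinite. Newtonian space and capacity: for measurable $f:X\to[-\infty,\infty]$ (defined everywhere), $\|f\|_{N^{1,p}(X)}=\bigl(\int_X|f|^p\,d\mu+\inf_g\int_X g^p\,d\mu\bigr)^{1/p}$, with infimum over all upper gradients $g$ of $f$, and $N^{1,p}(X)=\{f:\|f\|_{N^{1,p}(X)}<\infty\}$. For $E\subset X$, $C_p(E)=\inf_u\|u\|_{N^{1,p}(X)}^p$, the infimum being over all $u\in N^{1,p}(X)$ with $u\ge1$ on $E$. For a measurable set $U\subset X$, $N^{1,p}(U)$ and the intrinsic capacity $C_p^U$ are defined in the same way with $X$ replaced by the metric measure space $(U,d|_U,\mu|_U)$. A property holds q.e. (quasieverywhere) if the set where it fails has $C_p$-capacity zero. A set $U\subset X$ is quasiopen if for every $\varepsilon>0$ there is an open set $G\subset X$ with $C_p(G)<\varepsilon$ and $G\cup U$ open. Quasiopen sets are known to be measurable. A set $U\subset X$ is $p$-path open if for $p$-a.e. curve $\gamma:[0,l_\gamma]\to X$ the set $\gamma^{-1}(U)$ is relatively open in $[0,l_\gamma]$. Quasicontinuity: for measurable $U\subset X$, a function $u:U\to[-\infty,\infty]$ is $C_p^U$-quasicontinuous (resp. $C_p$-quasicontinuous) if for every $\varepsilon>0$ there is a relatively open set $G\subset U$ with $C_p^U(G)<\varepsilon$ (resp. an open set $G\subset X$ with $C_p(G)<\varepsilon$) such that $u|_{U\setminus G}$ is finite and continuous. On quasiopen $U$ the two notions are equivalent, and "quasicontinuous" may be read in either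 sense. *)

theory Defs
  imports "HOL-Analysis.Analysis"
begin

text \<open>
  The ambient metric space is a type of class \<^class>\<open>metric_space\<close>.  A metric measure space
  \<open>(S, d, \<mu>)\<close> with \<open>S\<close> a subset of that type is given by a measure \<open>M\<close> with \<open>space M = S\<close>; in
  particular \<open>(U, d|U, \<mu>|U)\<close> is \<open>restrict_space M U\<close>.  Functions on \<open>space M\<close> are total
  functions on the type whose values off \<open>space M\<close> play no role, and ``Borel'' means measurable
  with respect to \<open>restrict_space borel (space M)\<close>.
\<close>

text \<open>
  A complete Borel measure is the completion of a measure defined on the Borel sets.
\<close>

definition complete_borel_measure :: "'a::metric_space measure \<Rightarrow> bool" where
  "complete_borel_measure M \<longleftrightarrow> (\<exists>N. sets N = sets borel \<and> M = completion N)"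

definition metric_measure_space :: "'a::metric_space measure \<Rightarrow> bool" where
  "metric_measure_space M \<longleftrightarrow>
     complete_borel_measure M \<and> (\<forall>x r. emeasure M (ball x r) < \<infinity>)"

text \<open>Powers on \<open>[0,\<infinity>]\<close>, used only for positive exponents.\<close>

definition epowr :: "ennreal \<Rightarrow> real \<Rightarrow> ennreal" where
  "epowr x a = (if x = \<infinity> then \<infinity> else ennreal (enn2real x powr a))"


definition curve_length :: "(real \<Rightarrow> 'a::metric_space) \<Rightarrow> real \<Rightarrow> real \<Rightarrow> ennreal" where
  "curve_length \<gamma> a b =
     (SUP (n, t) \<in> {(n::nat, t). mono_on {..n} t \<and> t ` {..n} \<subseteq> {a..b}}.
        \<Sum>i<n. ennreal (dist (\<gamma> (t i)) (\<gamma> (t (Suc i)))))"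

text \<open>
  Nonconstant compact rectifiable curves in \<open>S\<close>, parameterized by arc length on \<open>{0..l}\<close>.
  They are nonconstant because their length \<open>l\<close> is positive.
\<close>

definition curve_in :: "'a::metric_space set \<Rightarrow> (real \<Rightarrow> 'a) \<Rightarrow> real \<Rightarrow> bool" where
  "curve_in S \<gamma> l \<longleftrightarrow>
     0 < l \<and> continuous_on {0..l} \<gamma> \<and> \<gamma> ` {0..l} \<subseteq> S \<and>
     (\<forall>s t. 0 \<le> s \<and> s \<le> t \<and> t \<le> l \<longrightarrow> curve_length \<gamma> s t = ennreal (t - s))"

definition curve_integral :: "('a::metric_space \<Rightarrow> ennreal) \<Rightarrow> (real \<Rightarrow> 'a) \<Rightarrow> real \<Rightarrow> ennreal" where
  "curve_integral \<rho> \<gamma> l = (\<integral>\<^sup>+t\<in>{0..l}. \<rho> (\<gamma> t) \<partial>lborel)"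

definition exceptional ::
    "real \<Rightarrow> 'a::metric_space measure \<Rightarrow> ((real \<Rightarrow> 'a) \<times> real) set \<Rightarrow> bool" where
  "exceptional p M \<Gamma> \<longleftrightarrow>
     (\<exists>\<rho>\<in>borel_measurable (restrict_space borel (space M)).
        (\<integral>\<^sup>+x. epowr (\<rho> x) p \<partial>M) < \<infinity> \<and>
        (\<forall>(\<gamma>, l)\<in>\<Gamma>. curve_integral \<rho> \<gamma> l = \<infinity>))"

text \<open>
  The property \<open>P\<close> holds for \<open>p\<close>-a.e. curve in \<open>S\<close>; exceptionality is always measured in \<open>M\<close>,
  also when \<open>S\<close> is a proper subset of \<open>space M\<close>.
\<close>

definition ae_curve ::
    "real \<Rightarrow> 'a::metric_space measure \<Rightarrow> 'a set \<Rightarrow> ((real \<Rightarrow> 'a) \<Rightarrow> real \<Rightarrow> bool) \<Rightarrow> bool" where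
  "ae_curve p M S P \<longleftrightarrow> exceptional p M {(\<gamma>, l). curve_in S \<gamma> l \<and> \<not> P \<gamma> l}"

text \<open>
  In \<^typ>\<open>ereal\<close> one has \<open>\<bar>a - b\<bar> = \<infinity>\<close> whenever \<open>a\<close> or \<open>b\<close> is infinite, also for
  \<open>\<infinity> - \<infinity>\<close>, which is the convention required for upper gradients.
\<close>

definition upper_gradient ::
    "'a::metric_space measure \<Rightarrow> ('a \<Rightarrow> ereal) \<Rightarrow> ('a \<Rightarrow> ennreal) \<Rightarrow> bool" where
  "upper_gradient M f g \<longleftrightarrow>
     g \<in> borel_measurable (restrict_space borel (space M)) \<and>
     (\<forall>\<gamma> l. curve_in (space M) \<gamma> l \<longrightarrow>
        e2ennreal \<bar>f (\<gamma> 0) - f (\<gamma> l)\<bar> \<le> curve_integral g \<gamma> l)"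

definition newtonian_norm ::
    "real \<Rightarrow> 'a::metric_space measure \<Rightarrow> ('a \<Rightarrow> ereal) \<Rightarrow> ennreal" where
  "newtonian_norm p M f =
     epowr ((\<integral>\<^sup>+x. epowr (e2ennreal \<bar>f x\<bar>) p \<partial>M) +
            (INF g\<in>{g. upper_gradient M f g}. \<integral>\<^sup>+x. epowr (g x) p \<partial>M)) (1 / p)"

definition newtonian_space ::
    "real \<Rightarrow> 'a::metric_space measure \<Rightarrow> ('a \<Rightarrow> ereal) set" where
  "newtonian_space p M = {f \<in> borel_measurable M. newtonian_norm p M f < \<infinity>}"

definition capacity :: "real \<Rightarrow> 'a::metric_space measure \<Rightarrow> 'a set \<Rightarrow> ennreal" where
  "capacity p M E =
     (INF u\<in>{u \<in> newtonian_space p M. \<forall>x\<in>E. 1 \<le> u x}. epowr (newtonian_norm p M u) p)"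

definition quasiopen :: "real \<Rightarrow> 'a::metric_space measure \<Rightarrow> 'a set \<Rightarrow> bool" where
  "quasiopen p M U \<longleftrightarrow>
     (\<forall>\<epsilon>>0. \<exists>G. open G \<and> capacity p M G < ennreal \<epsilon> \<and> open (G \<union> U))"

definition path_open :: "real \<Rightarrow> 'a::metric_space measure \<Rightarrow> 'a set \<Rightarrow> bool" where
  "path_open p M U \<longleftrightarrow>
     ae_curve p M UNIV (\<lambda>\<gamma> l. openin (top_of_set {0..l}) {t\<in>{0..l}. \<gamma> t \<in> U})"

text \<open>\<open>C\<^sub>p\<close>-quasicontinuity of \<open>u\<close> on \<open>U\<close>, with respect to the capacity of the whole space.\<close>

definition quasicontinuous ::
    "real \<Rightarrow> 'a::metric_space measure \<Rightarrow> 'a set \<Rightarrow> ('a \<Rightarrow> ereal) \<Rightarrow> bool" where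
  "quasicontinuous p M U u \<longleftrightarrow>
     (\<forall>\<epsilon>>0. \<exists>G. open G \<and> capacity p M G < ennreal \<epsilon> \<and>
        (\<forall>x\<in>U - G. \<bar>u x\<bar> \<noteq> \<infinity>) \<and> continuous_on (U - G) u)"

text \<open>\<open>C\<^sub>p\<^sup>U\<close>-quasicontinuity of \<open>u\<close> on \<open>U\<close>, with respect to the intrinsic capacity of \<open>U\<close>.\<close>

definition intrinsic_quasicontinuous ::
    "real \<Rightarrow> 'a::metric_space measure \<Rightarrow> 'a set \<Rightarrow> ('a \<Rightarrow> ereal) \<Rightarrow> bool" where
  "intrinsic_quasicontinuous p M U u \<longleftrightarrow>
     (\<forall>\<epsilon>>0. \<exists>G. openin (top_of_set U) G \<and> capacity p (restrict_space M U) G < ennreal \<epsilon> \<and>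
        (\<forall>x\<in>U - G. \<bar>u x\<bar> \<noteq> \<infinity>) \<and> continuous_on (U - G) u)"

definition finite_qe ::
    "real \<Rightarrow> 'a::metric_space measure \<Rightarrow> 'a set \<Rightarrow> ('a \<Rightarrow> ereal) \<Rightarrow> bool" where
  "finite_qe p M U u \<longleftrightarrow> capacity p M {x\<in>U. \<bar>u x\<bar> = \<infinity>} = 0"

end

theory Submission
  imports Defs
begin

text \<open>
  Sets of small capacity are missed by almost every curve: if \<open>C\<^sub>p(G\<^sub>j)\<close> tends to \<open>0\<close> fast enough, then
  \<open>p\<close>-almost every curve avoids some \<open>G\<^sub>j\<close>.  This gives the continuity of \<open>u\<close> along curves from
  quasicontinuity, and the \<open>p\<close>-path openness of quasiopen sets; the latter allows one to pass from
  curves in \<open>U\<close> to arbitrary curves by looking at subcurves.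

  Conversely, if \<open>u\<close> is continuous along almost every curve, then preimages of open sets are
  \<open>p\<close>-path open.  They need not be Borel in the whole space, but replacing \<open>U\<close> by a Borel superset
  that differs from it by a set of capacity zero makes them so, hence they are quasiopen.  A union
  over a countable basis of the exceptional open sets yields quasicontinuity.  A set of capacity
  zero is itself \<open>p\<close>-path open, since almost no curve meets it; if it is quasiopen, it has open
  neighbourhoods of arbitrarily small capacity, which takes care of the set where \<open>u\<close> is infinite.
\<close>

section \<open>Powers and suprema in the extended half-line\<close>

lemma epowr_0 [simp]: "epowr 0 a = 0"
  by (simp add: epowr_def)

lemma epowr_top [simp]: "epowr top a = top"
  by (simp add: epowr_def)

lemma epowr_1 [simp]: "epowr 1 a = 1"
  by (simp add: epowr_def)

lemma epowr_ennreal: "0 \<le> r \<Longrightarrow> epowr (ennreal r) a = ennreal (r powr a)"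
  by (simp add: epowr_def)

lemma epowr_mono: "0 < a \<Longrightarrow> x \<le> y \<Longrightarrow> epowr x a \<le> epowr y a"
  by (cases x; cases y) (auto simp: epowr_ennreal ennreal_le_iff2 powr_mono2 top_unique)

lemma epowr_inverse: "0 < a \<Longrightarrow> epowr (epowr x (1 / a)) a = x"
  by (cases x) (auto simp: epowr_ennreal powr_powr)

lemma epowr_inverse': "0 < a \<Longrightarrow> epowr (epowr x a) (1 / a) = x"
  by (cases x) (auto simp: epowr_ennreal powr_powr)

lemma epowr_mult: "0 < a \<Longrightarrow> 0 < c \<Longrightarrow> epowr (ennreal c * x) a = ennreal (c powr a) * epowr x a"
  by (cases x) (auto simp: epowr_ennreal powr_mult ennreal_mult_top ennreal_mult'[symmetric])

text \<open>The inverse power \<open>1 / a\<close> is monotone, so the bound on the powers becomes a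
  bound on the \<open>x i\<close> themselves, passes to the supremum, and is raised to the power
  \<open>a\<close> again.\<close>

lemma epowr_SUP_le:
  assumes "0 < a" "\<And>i. i \<in> I \<Longrightarrow> epowr (x i) a \<le> c"
  shows "epowr (SUP i\<in>I. x i) a \<le> c"
proof -
  have "x i \<le> epowr c (1 / a)" if "i \<in> I" for i
    using epowr_mono[OF _ assms(2)[OF that], of "1 / a"] assms(1) by (simp add: epowr_inverse')
  then have "(SUP i\<in>I. x i) \<le> epowr c (1 / a)"
    by (rule SUP_least)
  from epowr_mono[OF assms(1) this] show ?thesis
    using assms(1) by (simp add: epowr_inverse)
qed

text \<open>This is what makes suprema convenient for combining countably many functions: their
  \<open>p\<close>-th power integrals simply add up, without a triangle inequality for the
  norm.\<close>

lemma epowr_SUP_le_suminf: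
  fixes x :: "nat \<Rightarrow> ennreal"
  assumes "0 < a"
  shows "epowr (SUP n. x n) a \<le> (\<Sum>n. epowr (x n) a)"
proof (rule epowr_SUP_le[OF assms])
  fix n
  show "epowr (x n) a \<le> (\<Sum>n. epowr (x n) a)"
    using sum_le_suminf[of "\<lambda>n. epowr (x n) a" "{n}"] by simp
qed

lemma epowr_sup_le: "0 < a \<Longrightarrow> epowr (sup x y) a \<le> epowr x a + epowr y a"
  by (cases "x \<le> y") (auto simp: sup_absorb1 sup_absorb2)

lemma epowr_measurable [measurable]: "(\<lambda>x. epowr x a) \<in> borel_measurable borel"
  unfolding epowr_def by measurable

lemma less_top_epowr: "0 < a \<Longrightarrow> epowr x a < top \<longleftrightarrow> x < top"
  by (cases x) (auto simp: epowr_ennreal)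

section \<open>Reparameterization, subcurves and curve integrals\<close>

lemma curve_length_shift_le:
  "curve_length (\<lambda>t. \<gamma> (c + t)) a b \<le> curve_length \<gamma> (c + a) (c + b)"
  unfolding curve_length_def
proof (rule SUP_mono, clarify)
  fix n :: nat and t :: "nat \<Rightarrow> real"
  assume "mono_on {..n} t" "t ` {..n} \<subseteq> {a..b}"
  then have "mono_on {..n} (\<lambda>i. c + t i) \<and> (\<lambda>i. c + t i) ` {..n} \<subseteq> {c + a..c + b}"
    by (simp add: mono_on_def image_subset_iff)
  then show "\<exists>q\<in>{(n, t). mono_on {..n} t \<and> t ` {..n} \<subseteq> {c + a..c + b}}.
      (\<Sum>i<n. ennreal (dist (\<gamma> (c + t i)) (\<gamma> (c + t (Suc i)))))
      \<le> (case q of (n, t) \<Rightarrow> \<Sum>i<n. ennreal (dist (\<gamma> (t i)) (\<gamma> (t (Suc i)))))"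
    by (intro bexI[of _ "(n, \<lambda>i. c + t i)"]) auto
qed

text \<open>The reverse inequality is the same estimate for the shifted curve, with shift
  \<open>- c\<close>.\<close>

lemma curve_length_shift:
  "curve_length (\<lambda>t. \<gamma> (c + t)) a b = curve_length \<gamma> (c + a) (c + b)"
  using curve_length_shift_le[of \<gamma> c a b]
    curve_length_shift_le[of "\<lambda>t. \<gamma> (c + t)" "- c" "c + a" "c + b"] by simp

lemma curve_in_subcurve:
  assumes "curve_in S \<gamma> l" "0 \<le> a" "a < b" "b \<le> l" "\<gamma> ` {a..b} \<subseteq> T"
  shows "curve_in T (\<lambda>t. \<gamma> (a + t)) (b - a)"
proof -
  have "continuous_on {0..l} \<gamma>"
    using assms(1) by (simp add: curve_in_def)
  then have "continuous_on {0..b - a} (\<lambda>t. \<gamma> (a + t))"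
    by (rule continuous_on_compose2) (use assms(2,4) in \<open>auto intro: continuous_intros\<close>)
  moreover have "curve_length (\<lambda>t. \<gamma> (a + t)) s t = ennreal (t - s)"
    if "0 \<le> s" "s \<le> t" "t \<le> b - a" for s t
  proof -
    have "0 \<le> a + s \<and> a + s \<le> a + t \<and> a + t \<le> l"
      using assms(2,4) that by auto
    then have "curve_length \<gamma> (a + s) (a + t) = ennreal (a + t - (a + s))"
      using assms(1) unfolding curve_in_def by blast
    then show ?thesis
      by (simp add: curve_length_shift)
  qed
  ultimately show ?thesis
    using assms(3,5) by (simp add: curve_in_def image_subset_iff)
qed

lemma curve_in_mono: "curve_in S \<gamma> l \<Longrightarrow> S \<subseteq> T \<Longrightarrow> curve_in T \<gamma> l"
  unfolding curve_in_def by (meson subset_trans)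

text \<open>The curve is a measurable map into \<open>S\<close>, so it is enough that
  \<open>\<rho>\<close> is Borel relative to \<open>S\<close>. The indicator extends the composition
  by zero to the whole line.\<close>

lemma curve_measurable:
  fixes \<rho> :: "'a::metric_space \<Rightarrow> ennreal"
  assumes "curve_in S \<gamma> l" "\<rho> \<in> borel_measurable (restrict_space borel S)"
  shows "(\<lambda>t. \<rho> (\<gamma> t) * indicator {0..l} t) \<in> borel_measurable (borel :: real measure)"
proof -
  have "\<gamma> \<in> restrict_space borel {0..l} \<rightarrow>\<^sub>M restrict_space borel S"
    using assms(1) by (intro measurable_restrict_space2 borel_measurable_continuous_on_restrict)
      (auto simp: curve_in_def space_restrict_space)
  from measurable_compose[OF this assms(2)] show ?thesis
    using borel_measurable_restrict_space_iff_ennreal[of "{0..l}" borel "\<lambda>t. \<rho> (\<gamma> t)"] by simp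
qed

lemma curve_integral_subcurve_le:
  assumes \<gamma>: "curve_in S \<gamma> l" and \<rho>: "\<rho> \<in> borel_measurable (restrict_space borel S)"
    and "0 \<le> a" "a < b" "b \<le> l"
  shows "curve_integral \<rho> (\<lambda>t. \<gamma> (a + t)) (b - a) \<le> curve_integral \<rho> \<gamma> l"
proof -
  let ?F = "\<lambda>t. \<rho> (\<gamma> t) * indicator {0..l} t"
  have "curve_integral \<rho> (\<lambda>t. \<gamma> (a + t)) (b - a) \<le> (\<integral>\<^sup>+t. ?F (a + t) \<partial>lborel)"
    unfolding curve_integral_def using assms(3-)
    by (intro nn_integral_mono) (auto simp: indicator_def)
  \<comment> \<open>Translation invariance of Lebesgue measure.\<close>
  also have "\<dots> = (\<integral>\<^sup>+t. ?F t \<partial>lborel)"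
    using nn_integral_real_affine[OF curve_measurable[OF \<gamma> \<rho>], of 1 a] by simp
  finally show ?thesis
    by (simp add: curve_integral_def)
qed

lemma curve_integral_mono:
  assumes "curve_in S \<gamma> l" "\<And>x. x \<in> S \<Longrightarrow> \<rho> x \<le> \<rho>' x"
  shows "curve_integral \<rho> \<gamma> l \<le> curve_integral \<rho>' \<gamma> l"
  unfolding curve_integral_def using assms
  by (intro nn_integral_mono) (simp add: indicator_def curve_in_def image_subset_iff)

lemma curve_integral_cmult:
  assumes "curve_in S \<gamma> l" "\<rho> \<in> borel_measurable (restrict_space borel S)"
  shows "curve_integral (\<lambda>x. c * \<rho> x) \<gamma> l = c * curve_integral \<rho> \<gamma> l"
  unfolding curve_integral_def
  using nn_integral_cmult[of "\<lambda>t. \<rho> (\<gamma> t) * indicator {0..l} t" lborel c] curve_measurable[OF assms]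
  by (simp add: mult.assoc)

section \<open>Exceptional families and properties of almost every curve\<close>

text \<open>The pointwise maximum of the two weights has infinite integral along every curve of
  either family, and its \<open>p\<close>-th power is at most the sum of the two powers. The
  hypothesis \<open>sub\<close> makes relatively Borel weights measurable for
  \<open>M\<close>.\<close>

lemma exceptional_Un:
  assumes "0 < p" and sub: "sets (restrict_space borel (space M)) \<subseteq> sets M"
    and "exceptional p M \<Gamma>" "exceptional p M \<Gamma>'"
    and in_space: "\<And>\<gamma> l. (\<gamma>, l) \<in> \<Gamma> \<union> \<Gamma>' \<Longrightarrow> curve_in (space M) \<gamma> l"
  shows "exceptional p M (\<Gamma> \<union> \<Gamma>')"
proof -
  let ?B = "restrict_space borel (space M)"
  obtain \<rho> where \<rho>: "\<rho> \<in> borel_measurable ?B" "(\<integral>\<^sup>+x. epowr (\<rho> x) p \<partial>M) < \<infinity>"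
    "\<And>\<gamma> l. (\<gamma>, l) \<in> \<Gamma> \<Longrightarrow> curve_integral \<rho> \<gamma> l = \<infinity>"
    using assms(3) by (auto simp: exceptional_def)
  obtain \<rho>' where \<rho>': "\<rho>' \<in> borel_measurable ?B" "(\<integral>\<^sup>+x. epowr (\<rho>' x) p \<partial>M) < \<infinity>"
    "\<And>\<gamma> l. (\<gamma>, l) \<in> \<Gamma>' \<Longrightarrow> curve_integral \<rho>' \<gamma> l = \<infinity>"
    using assms(4) by (auto simp: exceptional_def)
  have sp: "space M = space ?B"
    by (simp add: space_restrict_space)
  have meas: "\<rho> \<in> borel_measurable M" "\<rho>' \<in> borel_measurable M"
    using \<rho>(1) \<rho>'(1) measurable_mono[OF order_refl refl sub, of borel] sp by auto
  let ?s = "\<lambda>x. sup (\<rho> x) (\<rho>' x)"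
  have "(\<integral>\<^sup>+x. epowr (?s x) p \<partial>M) \<le> (\<integral>\<^sup>+x. epowr (\<rho> x) p + epowr (\<rho>' x) p \<partial>M)"
    by (intro nn_integral_mono epowr_sup_le assms)
  also have "\<dots> = (\<integral>\<^sup>+x. epowr (\<rho> x) p \<partial>M) + (\<integral>\<^sup>+x. epowr (\<rho>' x) p \<partial>M)"
    using meas by (intro nn_integral_add) auto
  also have "\<dots> < \<infinity>"
    using \<rho>(2) \<rho>'(2) by simp
  finally have "(\<integral>\<^sup>+x. epowr (?s x) p \<partial>M) < \<infinity>" .
  moreover have "?s \<in> borel_measurable ?B"
    using \<rho>(1) \<rho>'(1) by measurable
  moreover have "curve_integral ?s \<gamma> l = \<infinity>" if "(\<gamma>, l) \<in> \<Gamma> \<union> \<Gamma>'" for \<gamma> l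
  proof -
    have "curve_integral \<rho> \<gamma> l \<le> curve_integral ?s \<gamma> l"
         "curve_integral \<rho>' \<gamma> l \<le> curve_integral ?s \<gamma> l"
      by (rule curve_integral_mono[OF in_space[OF that]], simp)+
    then show ?thesis
      using that \<rho>(3) \<rho>'(3) by (auto simp: top_unique)
  qed
  ultimately show ?thesis
    unfolding exceptional_def by (intro bexI[of _ ?s]) auto
qed

lemma exceptional_subset: "exceptional p M \<Gamma> \<Longrightarrow> \<Gamma>' \<subseteq> \<Gamma> \<Longrightarrow> exceptional p M \<Gamma>'"
  unfolding exceptional_def by blast

lemma ae_curve_mono:
  assumes "ae_curve p M S P" "\<And>\<gamma> l. curve_in T \<gamma> l \<Longrightarrow> P \<gamma> l \<Longrightarrow> Q \<gamma> l" "T \<subseteq> S"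
  shows "ae_curve p M T Q"
  unfolding ae_curve_def
proof (rule exceptional_subset[OF assms(1)[unfolded ae_curve_def]], clarify)
  fix \<gamma> l
  assume "curve_in T \<gamma> l" "\<not> Q \<gamma> l"
  then show "curve_in S \<gamma> l \<and> \<not> P \<gamma> l"
    using assms(2,3) curve_in_mono by metis
qed

lemma ae_curve_conj:
  assumes "0 < p" "sets (restrict_space borel (space M)) \<subseteq> sets M" "S \<subseteq> space M"
    and "ae_curve p M S P" "ae_curve p M S Q"
  shows "ae_curve p M S (\<lambda>\<gamma> l. P \<gamma> l \<and> Q \<gamma> l)"
  unfolding ae_curve_def
proof (rule exceptional_subset[OF exceptional_Un[OF assms(1,2) assms(4,5)[unfolded ae_curve_def]]])
  fix \<gamma> l
  assume "(\<gamma>, l) \<in> {(\<gamma>, l). curve_in S \<gamma> l \<and> \<not> P \<gamma> l} \<union> {(\<gamma>, l). curve_in S \<gamma> l \<and> \<not> Q \<gamma> l}"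
  then have "curve_in S \<gamma> l"
    by auto
  then show "curve_in (space M) \<gamma> l"
    using assms(3) by (rule curve_in_mono)
qed auto

text \<open>The weight \<open>\<rho>\<close> for the bad curves in \<open>S\<close> serves again:
  one bad subcurve already forces the integral over the whole curve to be infinite. In this way
  information about curves in \<open>U\<close> reaches curves that only partly run in
  \<open>U\<close>.\<close>

lemma ae_curve_subcurves:
  assumes "ae_curve p M S P" "space M = UNIV"
  shows "ae_curve p M T (\<lambda>\<gamma> l. \<forall>a b. 0 \<le> a \<and> a < b \<and> b \<le> l \<and> \<gamma> ` {a..b} \<subseteq> S \<longrightarrow>
           P (\<lambda>t. \<gamma> (a + t)) (b - a))"
proof -
  obtain \<rho> where \<rho>: "\<rho> \<in> borel_measurable (restrict_space borel (space M))"
    "(\<integral>\<^sup>+x. epowr (\<rho> x) p \<partial>M) < \<infinity>"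
    "\<And>\<gamma> l. curve_in S \<gamma> l \<Longrightarrow> \<not> P \<gamma> l \<Longrightarrow> curve_integral \<rho> \<gamma> l = \<infinity>"
    using assms(1) by (auto simp: exceptional_def ae_curve_def)
  have "curve_integral \<rho> \<gamma> l = \<infinity>"
    if "curve_in T \<gamma> l" "0 \<le> a" "a < b" "b \<le> l" "\<gamma> ` {a..b} \<subseteq> S"
      "\<not> P (\<lambda>t. \<gamma> (a + t)) (b - a)" for \<gamma> l a b
  proof -
    have "curve_integral \<rho> (\<lambda>t. \<gamma> (a + t)) (b - a) = \<infinity>"
      using \<rho>(3) curve_in_subcurve that by blast
    moreover have "curve_integral \<rho> (\<lambda>t. \<gamma> (a + t)) (b - a) \<le> curve_integral \<rho> \<gamma> l"
      using \<rho>(1) assms(2) that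
      by (intro curve_integral_subcurve_le[of UNIV]) (auto intro: curve_in_mono)
    ultimately show ?thesis
      by (simp add: top_unique)
  qed
  then show ?thesis
    unfolding ae_curve_def exceptional_def using \<rho>(1,2)
    by (intro bexI[of _ \<rho>] conjI) (simp_all, blast)
qed

section \<open>Test pairs for the capacity\<close>

text \<open>
  Test functions for the capacity can be truncated to \<open>[0,1]\<close>.  The gradient inequality is stated
  without differences, so that it passes to suprema.
\<close>

definition capacity_pair ::
    "'a::metric_space measure \<Rightarrow> ('a \<Rightarrow> ennreal) \<Rightarrow> ('a \<Rightarrow> ennreal) \<Rightarrow> bool" where
  "capacity_pair M f g \<longleftrightarrow>
     f \<in> borel_measurable M \<and> (\<forall>x. f x \<le> 1) \<and>
     g \<in> borel_measurable (restrict_space borel (space M)) \<and>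
     (\<forall>\<gamma> l. curve_in (space M) \<gamma> l \<longrightarrow>
        f (\<gamma> 0) \<le> f (\<gamma> l) + curve_integral g \<gamma> l \<and>
        f (\<gamma> l) \<le> f (\<gamma> 0) + curve_integral g \<gamma> l)"

text \<open>Truncation to \<open>[0,1]\<close> is 1-Lipschitz. If the difference is infinite, in
  particular for two equal infinities, the right-hand side is infinite.\<close>

lemma min_e2ennreal_le:
  "min 1 (e2ennreal a) \<le> min 1 (e2ennreal b) + e2ennreal \<bar>a - b\<bar>"
proof (cases "\<bar>a - b\<bar> = \<infinity>")
  case True
  then show ?thesis
    by simp
next
  case False
  then obtain r s where rs: "a = ereal r" "b = ereal s"
    by (cases a; cases b) auto
  have min_eq: "min 1 (ennreal x) = ennreal (min 1 x)" for x
    by (simp add: min_def)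
  have "ennreal (min 1 r) \<le> ennreal (max 0 (min 1 s) + \<bar>r - s\<bar>)"
    by (intro ennreal_leI) auto
  also have "\<dots> = ennreal (max 0 (min 1 s)) + ennreal \<bar>r - s\<bar>"
    by (intro ennreal_plus) auto
  also have "ennreal (max 0 (min 1 s)) = ennreal (min 1 s)"
    by (auto simp: max_def ennreal_neg)
  finally have "min 1 (ennreal r) \<le> min 1 (ennreal s) + ennreal \<bar>r - s\<bar>"
    by (simp only: min_eq)
  then show ?thesis
    by (simp add: rs e2ennreal_ereal)
qed

lemma e2ennreal_abs_diff_le:
  assumes "a \<le> 1" "b \<le> 1" "a \<le> b + c" "b \<le> a + c"
  shows "e2ennreal \<bar>enn2ereal a - enn2ereal b\<bar> \<le> c"
proof -
  obtain r where r: "a = ennreal r" "0 \<le> r"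
    using assms(1) by (cases a) (auto simp: top_unique)
  obtain s where s: "b = ennreal s" "0 \<le> s"
    using assms(2) by (cases b) (auto simp: top_unique)
  show ?thesis
  proof (cases c)
    case (real t)
    then have "r \<le> s + t" "s \<le> r + t"
      using assms(3,4) r s by (auto simp flip: ennreal_plus)
    then show ?thesis
      using r s real by (simp add: enn2ereal_ennreal e2ennreal_ereal ennreal_leI abs_le_iff)
  qed simp
qed

text \<open>A strict bound on both nested infima is witnessed by one function and one gradient.
  Truncating the function to \<open>[0,1]\<close> keeps the gradient and does not increase the
  integral; conversely a pair is itself admissible after embedding into the extended reals.\<close>

lemma capacity_less_iff:
  assumes "0 < p"
  shows "capacity p M E < \<delta> \<longleftrightarrow>
    (\<exists>f g. capacity_pair M f g \<and> (\<forall>x\<in>E. f x = 1) \<and>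
       (\<integral>\<^sup>+x. epowr (f x) p \<partial>M) + (\<integral>\<^sup>+x. epowr (g x) p \<partial>M) < \<delta>)"
    (is "_ \<longleftrightarrow> ?rhs")
proof
  assume "capacity p M E < \<delta>"
  then obtain u where u: "u \<in> borel_measurable M" "\<And>x. x \<in> E \<Longrightarrow> 1 \<le> u x"
    "epowr (newtonian_norm p M u) p < \<delta>"
    by (auto simp: capacity_def INF_less_iff newtonian_space_def)
  let ?A = "\<integral>\<^sup>+x. epowr (e2ennreal \<bar>u x\<bar>) p \<partial>M"
  have less: "?A + (INF g\<in>{g. upper_gradient M u g}. \<integral>\<^sup>+x. epowr (g x) p \<partial>M) < \<delta>"
    using u(3) assms by (simp add: newtonian_norm_def epowr_inverse)
  \<comment> \<open>Finiteness of the first integral allows it to be subtracted, so the strict bound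
    is one on the infimum over gradients and produces an actual gradient \<open>g\<close>.\<close>
  then have fin: "?A \<noteq> top"
    by auto
  with less have "(INF g\<in>{g. upper_gradient M u g}. \<integral>\<^sup>+x. epowr (g x) p \<partial>M) < \<delta> - ?A"
    by (metis add.commute less_diff_eq_ennreal less_top)
  then obtain g where g: "upper_gradient M u g" "(\<integral>\<^sup>+x. epowr (g x) p \<partial>M) < \<delta> - ?A"
    by (auto simp: INF_less_iff)
  let ?f = "\<lambda>x. min 1 (e2ennreal (u x))"
  have "u x \<le> \<bar>u x\<bar>" for x
    by (cases "u x") auto
  then have "(\<integral>\<^sup>+x. epowr (?f x) p \<partial>M) \<le> ?A"
    by (intro nn_integral_mono epowr_mono assms min.coboundedI2 e2ennreal_mono)
  then have "(\<integral>\<^sup>+x. epowr (?f x) p \<partial>M) + (\<integral>\<^sup>+x. epowr (g x) p \<partial>M) \<le> ?A + (\<integral>\<^sup>+x. epowr (g x) p \<partial>M)"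
    by (rule add_right_mono)
  also have "\<dots> < \<delta>"
    using g(2) fin by (metis add.commute less_diff_eq_ennreal less_top)
  finally have "(\<integral>\<^sup>+x. epowr (?f x) p \<partial>M) + (\<integral>\<^sup>+x. epowr (g x) p \<partial>M) < \<delta>" .
  moreover have "capacity_pair M ?f g"
    unfolding capacity_pair_def
  proof (intro conjI allI impI)
    show "?f \<in> borel_measurable M"
      using u(1) by measurable
    show "g \<in> borel_measurable (restrict_space borel (space M))"
      using g(1) by (simp add: upper_gradient_def)
    fix \<gamma> l
    assume "curve_in (space M) \<gamma> l"
    then have ug: "e2ennreal \<bar>u (\<gamma> 0) - u (\<gamma> l)\<bar> \<le> curve_integral g \<gamma> l"
      using g(1) by (simp add: upper_gradient_def)
    have "\<bar>u (\<gamma> l) - u (\<gamma> 0)\<bar> = \<bar>u (\<gamma> 0) - u (\<gamma> l)\<bar>"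
      by (cases "u (\<gamma> 0)"; cases "u (\<gamma> l)") auto
    then show "?f (\<gamma> 0) \<le> ?f (\<gamma> l) + curve_integral g \<gamma> l"
         "?f (\<gamma> l) \<le> ?f (\<gamma> 0) + curve_integral g \<gamma> l"
      using min_e2ennreal_le[of "u (\<gamma> 0)" "u (\<gamma> l)"] min_e2ennreal_le[of "u (\<gamma> l)" "u (\<gamma> 0)"] ug
      by (metis add_left_mono order_trans)+
  qed simp
  moreover have "\<forall>x\<in>E. ?f x = 1"
    using e2ennreal_mono[OF u(2)] by (simp add: one_ereal_def min_absorb1)
  ultimately show ?rhs
    by blast
next
  assume ?rhs
  then obtain f g where fg: "capacity_pair M f g" "\<And>x. x \<in> E \<Longrightarrow> f x = 1"
    "(\<integral>\<^sup>+x. epowr (f x) p \<partial>M) + (\<integral>\<^sup>+x. epowr (g x) p \<partial>M) < \<delta>"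
    by blast
  let ?u = "\<lambda>x. enn2ereal (f x)"
  let ?X = "(\<integral>\<^sup>+x. epowr (e2ennreal \<bar>?u x\<bar>) p \<partial>M) +
            (INF g\<in>{g. upper_gradient M ?u g}. \<integral>\<^sup>+x. epowr (g x) p \<partial>M)"
  have "upper_gradient M ?u g"
    using fg(1) unfolding upper_gradient_def capacity_pair_def
    by (blast intro: e2ennreal_abs_diff_le)
  then have "?X \<le> (\<integral>\<^sup>+x. epowr (f x) p \<partial>M) + (\<integral>\<^sup>+x. epowr (g x) p \<partial>M)"
    by (intro add_mono INF_lower) auto
  with fg(3) have X: "?X < \<delta>"
    by (rule order.strict_trans1[rotated])
  then have "?X < top"
    by (rule less_le_trans) simp
  then have "newtonian_norm p M ?u < \<infinity>"
    unfolding newtonian_norm_def infinity_ennreal_def using assms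
    by (subst less_top_epowr) simp_all
  moreover have "?u \<in> borel_measurable M"
    using fg(1) unfolding capacity_pair_def by (auto intro: measurable_compose[OF _ measurable_enn2ereal])
  ultimately have "capacity p M E \<le> epowr (newtonian_norm p M ?u) p"
    unfolding capacity_def using fg(2)
    by (intro INF_lower) (auto simp: newtonian_space_def one_ennreal.rep_eq)
  also have "\<dots> < \<delta>"
    using X assms by (simp add: newtonian_norm_def epowr_inverse)
  finally show "capacity p M E < \<delta>" .
qed

section \<open>Monotonicity and subadditivity of the capacity\<close>

lemma capacity_mono: "E \<subseteq> F \<Longrightarrow> capacity p M E \<le> capacity p M F"
  unfolding capacity_def by (intro INF_superset_mono) auto

text \<open>The suprema of the test functions and of their gradients again form a test pair, and
  their energies are dominated by the sum of the individual energies.\<close>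

lemma capacity_UN_less:
  fixes \<epsilon> :: real
  assumes "0 < p" "0 < \<epsilon>" and sub: "sets (restrict_space borel (space M)) \<subseteq> sets M"
    and E: "\<And>n::nat. capacity p M (E n) < ennreal (\<epsilon> * (1/2) ^ Suc (Suc n))"
  shows "capacity p M (\<Union>n. E n) < ennreal \<epsilon>"
proof -
  have "\<exists>f g. capacity_pair M f g \<and> (\<forall>x\<in>E n. f x = 1) \<and>
       (\<integral>\<^sup>+x. epowr (f x) p \<partial>M) + (\<integral>\<^sup>+x. epowr (g x) p \<partial>M) < ennreal (\<epsilon> * (1/2) ^ Suc (Suc n))" for n
    using E assms(1) by (simp only: capacity_less_iff)
  then obtain f g where fg: "\<And>n. capacity_pair M (f n) (g n)" "\<And>n x. x \<in> E n \<Longrightarrow> f n x = 1"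
    "\<And>n. (\<integral>\<^sup>+x. epowr (f n x) p \<partial>M) + (\<integral>\<^sup>+x. epowr (g n x) p \<partial>M) < ennreal (\<epsilon> * (1/2) ^ Suc (Suc n))"
    by metis
  let ?f = "\<lambda>x. SUP n. f n x" and ?g = "\<lambda>x. SUP n. g n x"
  have f: "\<And>n. f n \<in> borel_measurable M" "\<And>n x. f n x \<le> 1"
    and g': "\<And>n. g n \<in> borel_measurable (restrict_space borel (space M))"
    and grad: "\<And>n \<gamma> l. curve_in (space M) \<gamma> l \<Longrightarrow>
        f n (\<gamma> 0) \<le> f n (\<gamma> l) + curve_integral (g n) \<gamma> l \<and>
        f n (\<gamma> l) \<le> f n (\<gamma> 0) + curve_integral (g n) \<gamma> l"
    using fg(1) by (auto simp: capacity_pair_def)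
  have g: "g n \<in> borel_measurable M" for n
    using g'[of n] measurable_mono[OF order_refl refl sub, of borel]
    by (auto simp: space_restrict_space)
  have int_le: "(\<integral>\<^sup>+x. epowr (SUP n. h n x) p \<partial>M) \<le> (\<Sum>n. \<integral>\<^sup>+x. epowr (h n x) p \<partial>M)"
    if "\<And>n. h n \<in> borel_measurable M" for h :: "nat \<Rightarrow> 'a \<Rightarrow> ennreal"
    using that by (subst nn_integral_suminf[symmetric])
      (auto intro!: nn_integral_mono epowr_SUP_le_suminf assms(1))
  have "(\<integral>\<^sup>+x. epowr (?f x) p \<partial>M) + (\<integral>\<^sup>+x. epowr (?g x) p \<partial>M)
      \<le> (\<Sum>n. \<integral>\<^sup>+x. epowr (f n x) p \<partial>M) + (\<Sum>n. \<integral>\<^sup>+x. epowr (g n x) p \<partial>M)"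
    by (intro add_mono int_le f g)
  also have "\<dots> = (\<Sum>n. (\<integral>\<^sup>+x. epowr (f n x) p \<partial>M) + (\<integral>\<^sup>+x. epowr (g n x) p \<partial>M))"
    by (rule suminf_add) simp_all
  also have "\<dots> \<le> (\<Sum>n. ennreal (\<epsilon> * (1/2) ^ Suc (Suc n)))"
    by (intro suminf_le less_imp_le[OF fg(3)]) simp_all
  \<comment> \<open>Summing the strict bounds only gives a weak one. The bounds are scaled to add up
    to half of \<open>\<epsilon>\<close>, which restores strictness.\<close>
  also have "\<dots> = ennreal (\<epsilon> / 2)"
  proof (rule suminf_ennreal_eq)
    have "(\<lambda>n. \<epsilon> / 2 * (1/2) ^ Suc n) sums (\<epsilon> / 2 * 1)"
      by (intro sums_mult power_half_series)
    then show "(\<lambda>n. \<epsilon> * (1/2) ^ Suc (Suc n)) sums (\<epsilon> / 2)"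
      by simp
  qed (use assms in auto)
  also have "\<dots> < ennreal \<epsilon>"
    using assms(2) by (simp add: ennreal_less_iff)
  finally have "(\<integral>\<^sup>+x. epowr (?f x) p \<partial>M) + (\<integral>\<^sup>+x. epowr (?g x) p \<partial>M) < ennreal \<epsilon>" .
  moreover have "capacity_pair M ?f ?g"
    unfolding capacity_pair_def
  proof (intro conjI allI impI)
    show "?f \<in> borel_measurable M" "?g \<in> borel_measurable (restrict_space borel (space M))"
      using f(1) g' by measurable
    show "?f x \<le> 1" for x
      by (intro SUP_least f)
    fix \<gamma> l
    assume \<gamma>: "curve_in (space M) \<gamma> l"
    have *: "f n x + curve_integral (g n) \<gamma> l \<le> ?f x + curve_integral ?g \<gamma> l" for n x
      by (intro add_mono curve_integral_mono[OF \<gamma>] SUP_upper) auto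
    show "?f (\<gamma> 0) \<le> ?f (\<gamma> l) + curve_integral ?g \<gamma> l"
      using grad[OF \<gamma>] * by (intro SUP_least) (meson order_trans)
    show "?f (\<gamma> l) \<le> ?f (\<gamma> 0) + curve_integral ?g \<gamma> l"
      using grad[OF \<gamma>] * by (intro SUP_least) (meson order_trans)
  qed
  moreover have "?f x = 1" if "x \<in> (\<Union>n. E n)" for x
  proof (rule antisym)
    show "?f x \<le> 1"
      by (intro SUP_least f)
    show "1 \<le> ?f x"
      using that fg(2) SUP_upper[of _ UNIV "\<lambda>n. f n x"] by (metis UN_E UNIV_I)
  qed
  ultimately show ?thesis
    unfolding capacity_less_iff[OF assms(1)]
    by (intro exI[of _ ?f] exI[of _ ?g] conjI ballI)
qed

lemma capacity_empty:
  assumes "0 < p"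
  shows "capacity p M {} = 0"
proof (rule ccontr)
  assume "capacity p M {} \<noteq> 0"
  moreover have "capacity_pair M (\<lambda>_. 0) (\<lambda>_. 0)"
    by (simp add: capacity_pair_def)
  ultimately have "capacity p M {} < capacity p M {}"
    by (subst capacity_less_iff[OF assms]) (auto intro!: exI[of _ "\<lambda>_. 0"] simp: zero_less_iff_neq_zero)
  then show False
    by simp
qed

text \<open>The countable version is applied to \<open>E\<close>, \<open>F\<close> and then empty
  sets. Its first two bounds are \<open>\<epsilon> / 4\<close> and \<open>\<epsilon> / 8\<close>, so
  \<open>\<epsilon> / 8\<close> suffices for both sets.\<close>

lemma capacity_Un_less:
  fixes \<epsilon> :: real
  assumes "0 < p" "0 < \<epsilon>" and sub: "sets (restrict_space borel (space M)) \<subseteq> sets M"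
    and "capacity p M E < ennreal (\<epsilon> / 8)" "capacity p M F < ennreal (\<epsilon> / 8)"
  shows "capacity p M (E \<union> F) < ennreal \<epsilon>"
proof -
  define A where "A n = (if n = 0 then E else if n = 1 then F else {})" for n :: nat
  have "capacity p M (A n) < ennreal (\<epsilon> * (1/2) ^ Suc (Suc n))" for n
  proof -
    have "capacity p M E < ennreal (\<epsilon> / 4)"
      using assms(2,4) by (elim less_le_trans) (simp add: ennreal_leI)
    then show ?thesis
      using assms by (auto simp: A_def capacity_empty)
  qed
  then have "capacity p M (\<Union>n. A n) < ennreal \<epsilon>"
    by (intro capacity_UN_less assms)
  also have "(\<Union>n. A n) = E \<union> F"
    by (auto simp: A_def split: if_splits)
  finally show ?thesis .
qed
text \<open>A test pair controls only the end points of curves; applied to the subcurve between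
  \<open>s\<close> and \<open>t\<close>, in whichever order they come, it controls any two
  points.\<close>

lemma capacity_pair_le:
  assumes "capacity_pair M f g" "curve_in (space M) \<gamma> l" "s \<in> {0..l}" "t \<in> {0..l}"
  shows "f (\<gamma> s) \<le> f (\<gamma> t) + curve_integral g \<gamma> l"
proof -
  have sub: "f (\<gamma> a) \<le> f (\<gamma> b) + curve_integral g \<gamma> l \<and> f (\<gamma> b) \<le> f (\<gamma> a) + curve_integral g \<gamma> l"
    if "0 \<le> a" "a < b" "b \<le> l" for a b
  proof -
    have "\<gamma> ` {a..b} \<subseteq> space M"
      using assms(2) that unfolding curve_in_def image_subset_iff by auto
    then have "curve_in (space M) (\<lambda>t. \<gamma> (a + t)) (b - a)"
      by (rule curve_in_subcurve[OF assms(2) that])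
    then have "f (\<gamma> a) \<le> f (\<gamma> b) + curve_integral g (\<lambda>t. \<gamma> (a + t)) (b - a)"
      "f (\<gamma> b) \<le> f (\<gamma> a) + curve_integral g (\<lambda>t. \<gamma> (a + t)) (b - a)"
      using assms(1) unfolding capacity_pair_def by force+
    moreover have "curve_integral g (\<lambda>t. \<gamma> (a + t)) (b - a) \<le> curve_integral g \<gamma> l"
      using assms(1) that
      by (intro curve_integral_subcurve_le[OF assms(2)]) (simp_all add: capacity_pair_def)
    ultimately show ?thesis
      by (meson add_left_mono order_trans)
  qed
  show ?thesis
    using sub[of s t] sub[of t s] assms(3,4) by (cases s t rule: linorder_cases) auto
qed

lemma capacity_eq_0I:
  assumes "\<And>\<epsilon>. 0 < \<epsilon> \<Longrightarrow> capacity p M E < ennreal \<epsilon>"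
  shows "capacity p M E = 0"
proof (cases "capacity p M E")
  case (real r)
  show ?thesis
  proof (rule ccontr)
    assume "capacity p M E \<noteq> 0"
    then have "0 < r"
      using real by (auto simp: order_less_le)
    from assms[OF this] show False
      by (simp add: real(2))
  qed
next
  case top
  then show ?thesis
    using assms[of 1] by simp
qed

text \<open>Subcurves live on nondegenerate compact intervals. This provides one inside a relatively
  open parameter set; the agreement with \<open>T\<close> near \<open>t\<close> lets limits at
  \<open>t\<close> be computed in either set.\<close>

lemma openin_Icc_nbhd:
  fixes l t :: real
  assumes "openin (top_of_set {0..l}) T" "0 < l" "t \<in> T"
  obtains a b \<delta> where "0 \<le> a" "a < b" "b \<le> l" "t \<in> {a..b}" "{a..b} \<subseteq> T"
    "0 < \<delta>" "{a..b} \<inter> ball t \<delta> = T \<inter> ball t \<delta>"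
proof -
  obtain e where e: "0 < e" "ball t e \<inter> {0..l} \<subseteq> T" and T: "T \<subseteq> {0..l}"
    using assms(1,3) by (auto simp: openin_contains_ball)
  \<comment> \<open>Half the radius keeps the closed interval inside the open ball. Clipping to
    \<open>{0..l}\<close> leaves it nondegenerate even when \<open>t\<close> is an end point,
    because \<open>0 < l\<close>.\<close>
  define a b where "a = max 0 (t - e / 2)" and "b = min l (t + e / 2)"
  have t: "0 \<le> t" "t \<le> l"
    using T assms(3) by auto
  have ab: "0 \<le> a" "a < b" "b \<le> l" "t \<in> {a..b}"
    using t e(1) assms(2) by (auto simp: a_def b_def)
  have "{a..b} \<subseteq> ball t e \<inter> {0..l}"
    using e(1) by (auto simp: a_def b_def dist_real_def)
  then have sub: "{a..b} \<subseteq> T"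
    using e(2) by blast
  moreover have "T \<inter> ball t (e / 2) \<subseteq> {a..b}"
  proof
    fix x
    assume "x \<in> T \<inter> ball t (e / 2)"
    then have "0 \<le> x" "x \<le> l" "\<bar>t - x\<bar> < e / 2"
      using T by (auto simp: dist_real_def)
    then have "0 \<le> x" "x \<le> l" "t - e / 2 \<le> x" "x \<le> t + e / 2"
      by linarith+
    then show "x \<in> {a..b}"
      by (auto simp: a_def b_def)
  qed
  ultimately have "{a..b} \<inter> ball t (e / 2) = T \<inter> ball t (e / 2)"
    by blast
  then show ?thesis
    using ab sub e(1) by (intro that[of a b "e / 2"]) auto
qed

section \<open>Measurability and completeness in the ambient space\<close>

locale complete_borel_space =
  fixes M :: "'a::metric_space measure" and p :: real
  assumes complete_borel: "complete_borel_measure M" and p_pos: "0 < p"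
begin

lemma space_M: "space M = UNIV"
proof -
  obtain N where "sets N = sets borel" "M = completion N"
    using complete_borel by (auto simp: complete_borel_measure_def)
  then show ?thesis
    using sets_eq_imp_space_eq[of N borel] by simp
qed

lemma borel_sets: "A \<in> sets borel \<Longrightarrow> A \<in> sets M"
  using complete_borel by (auto simp: complete_borel_measure_def)

lemma null_subset: "A \<in> null_sets M \<Longrightarrow> B \<subseteq> A \<Longrightarrow> B \<in> null_sets M"
  using complete_borel null_sets_completion_subset by (auto simp: complete_borel_measure_def)

lemma restrict_borel_sets:
  "sets (restrict_space borel (space (restrict_space M U))) \<subseteq> sets (restrict_space M U)"
  using borel_sets by (auto simp: sets_restrict_space space_restrict_space space_M)

lemma restrict_borel_sets': "sets (restrict_space borel (space M)) \<subseteq> sets M"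
  using borel_sets by (auto simp: sets_restrict_space space_M)

text \<open>Statements about the intrinsic capacity of \<open>U\<close> thereby specialize to the
  capacity of the whole space.\<close>

lemma restrict_UNIV: "restrict_space M UNIV = M"
  using sets.top[of M]
  by (intro measure_eqI) (auto simp: sets_restrict_space emeasure_restrict_space space_M)

text \<open>Borel majorants are needed since the functions witnessing exceptionality must be Borel.\<close>

lemma borel_majorant:
  fixes f :: "'a \<Rightarrow> ennreal"
  assumes U: "U \<in> sets M" and f: "f \<in> borel_measurable (restrict_space M U)"
  obtains v where "v \<in> borel_measurable borel" "\<And>x. x \<in> U \<Longrightarrow> f x \<le> v x"
    "(\<integral>\<^sup>+x. epowr (v x) p \<partial>M) = (\<integral>\<^sup>+x. epowr (f x) p \<partial>restrict_space M U)"
proof -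
  obtain N where N: "sets N = sets borel" "M = completion N"
    using complete_borel by (auto simp: complete_borel_measure_def)
  have U': "U \<inter> space M \<in> sets M"
    using U by (simp add: space_M)
  let ?f = "\<lambda>x. f x * indicator U x"
  have "?f \<in> borel_measurable M"
    using f borel_measurable_restrict_space_iff_ennreal[OF U'] by blast
  then obtain g where g: "g \<in> borel_measurable N" "AE x in N. ?f x = g x"
    using completion_ex_borel_measurable[of ?f N] N(2) by blast
  from g(2) obtain K where K: "{x \<in> space N. ?f x \<noteq> g x} \<subseteq> K" "emeasure N K = 0" "K \<in> sets N"
    by (rule AE_E)
  have spN: "space N = UNIV"
    using sets_eq_imp_space_eq[OF N(1)] by simp
  \<comment> \<open>The Borel function \<open>g\<close> agrees with \<open>?f\<close> only off the
    null set \<open>K\<close>. The value \<open>top\<close> on \<open>K\<close> makes the bound hold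
    everywhere without changing the integral.\<close>
  let ?v = "\<lambda>x. if x \<in> K then top else g x"
  have "?v \<in> borel_measurable N"
    using K(3) g(1) by measurable
  then have "?v \<in> borel_measurable borel"
    using measurable_cong_sets[OF N(1) refl] by blast
  moreover have "f x \<le> ?v x" if "x \<in> U" for x
  proof (cases "x \<in> K")
    case False
    then have "?f x = g x"
      using K(1) by (auto simp: spN)
    then show ?thesis
      using False that by simp
  qed simp
  moreover have "(\<integral>\<^sup>+x. epowr (?v x) p \<partial>M) = (\<integral>\<^sup>+x. epowr (f x) p \<partial>restrict_space M U)"
  proof -
    have "AE x in N. x \<notin> K"
      using K by (intro AE_not_in) (simp add: null_sets_def)
    then have "AE x in N. epowr (?v x) p = epowr (f x) p * indicator U x"
    proof eventually_elim
      case (elim x)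
      then have "?f x = g x"
        using K(1) by (auto simp: spN)
      then show ?case
        using elim by (auto simp: indicator_def split: if_splits)
    qed
    then have "(\<integral>\<^sup>+x. epowr (?v x) p \<partial>M) = (\<integral>\<^sup>+x. epowr (f x) p * indicator U x \<partial>M)"
      unfolding N(2) by (intro nn_integral_cong_AE AE_completion)
    then show ?thesis
      by (simp add: nn_integral_restrict_space[OF U'])
  qed
  ultimately show ?thesis
    by (rule that)
qed

section \<open>Curves meeting sets of small or zero capacity\<close>

text \<open>
  If \<open>f = 1\<close> somewhere on a curve, then either the upper gradient has integral at least \<open>1/2\<close>
  along the curve or \<open>f \<ge> 1/2\<close> on the whole curve.  So sets of small capacity can only be hit by
  curves along which functions of small norm have integrals bounded from below.
\<close>

lemma ae_curve_misses:
  assumes U: "U \<in> sets M"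
    and ex: "\<And>\<epsilon>. 0 < \<epsilon> \<Longrightarrow> \<exists>G. Q G \<and> capacity p (restrict_space M U) G < ennreal \<epsilon>"
  shows "ae_curve p M U (\<lambda>\<gamma> l. \<exists>G. Q G \<and> \<gamma> ` {0..l} \<inter> G = {})"
proof -
  let ?R = "restrict_space M U"
  have spR: "space ?R = U"
    by (simp add: space_restrict_space space_M)
  \<comment> \<open>The denominator cancels the factor that the multiplier \<open>Suc n\<close> in
    \<open>\<rho>\<close> contributes after taking powers; what remains is summable.\<close>
  define c where "c n = (1/2) ^ n / real (Suc n) powr p" for n
  have c: "0 < c n" for n
    by (simp add: c_def)
  obtain G where G: "\<And>n. Q (G n)" "\<And>n. capacity p ?R (G n) < ennreal (c n)"
    using ex[OF c] by metis
  have "\<exists>f g. capacity_pair ?R f g \<and> (\<forall>x\<in>G n. f x = 1) \<and>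
       (\<integral>\<^sup>+x. epowr (f x) p \<partial>?R) + (\<integral>\<^sup>+x. epowr (g x) p \<partial>?R) < ennreal (c n)" for n
    using G(2)[of n] by (simp only: capacity_less_iff[OF p_pos])
  then obtain f g where fg: "\<And>n. capacity_pair ?R (f n) (g n)" "\<And>n x. x \<in> G n \<Longrightarrow> f n x = 1"
    "\<And>n. (\<integral>\<^sup>+x. epowr (f n x) p \<partial>?R) + (\<integral>\<^sup>+x. epowr (g n x) p \<partial>?R) < ennreal (c n)"
    by metis
  have f: "f n \<in> borel_measurable ?R" for n
    using fg(1)[of n] by (simp add: capacity_pair_def)
  have "g n \<in> borel_measurable (restrict_space borel U)" for n
    using fg(1)[of n] by (simp add: capacity_pair_def spR)
  then have g: "g n \<in> borel_measurable ?R" for n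
    using measurable_mono[OF order_refl refl restrict_borel_sets[of U], of borel]
    by (auto simp: space_restrict_space space_M)
  have "\<exists>v. v \<in> borel_measurable borel \<and> (\<forall>x\<in>U. f n x \<le> v x) \<and>
      (\<integral>\<^sup>+x. epowr (v x) p \<partial>M) = (\<integral>\<^sup>+x. epowr (f n x) p \<partial>?R)" for n
    using borel_majorant[OF U f[of n]] by metis
  then obtain v where v: "\<And>n. v n \<in> borel_measurable borel" "\<And>n x. x \<in> U \<Longrightarrow> f n x \<le> v n x"
    "\<And>n. (\<integral>\<^sup>+x. epowr (v n x) p \<partial>M) = (\<integral>\<^sup>+x. epowr (f n x) p \<partial>?R)"
    by metis
  have "\<exists>v. v \<in> borel_measurable borel \<and> (\<forall>x\<in>U. g n x \<le> v x) \<and>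
      (\<integral>\<^sup>+x. epowr (v x) p \<partial>M) = (\<integral>\<^sup>+x. epowr (g n x) p \<partial>?R)" for n
    using borel_majorant[OF U g[of n]] by metis
  then obtain w where w: "\<And>n. w n \<in> borel_measurable borel" "\<And>n x. x \<in> U \<Longrightarrow> g n x \<le> w n x"
    "\<And>n. (\<integral>\<^sup>+x. epowr (w n x) p \<partial>M) = (\<integral>\<^sup>+x. epowr (g n x) p \<partial>?R)"
    by metis
  define \<sigma> where "\<sigma> n x = sup (v n x) (w n x)" for n x
  \<comment> \<open>The integrals of the \<open>\<sigma> n\<close> along a curve meeting every
    \<open>G n\<close> have a common positive lower bound; the multipliers make it blow up.\<close>
  define \<rho> where "\<rho> x = (SUP n. ennreal (real (Suc n)) * \<sigma> n x)" for x
  have \<sigma>: "\<sigma> n \<in> borel_measurable borel" for n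
    unfolding \<sigma>_def using v(1) w(1) by measurable
  then have \<rho>: "\<rho> \<in> borel_measurable borel"
    unfolding \<rho>_def by measurable
  have M_meas: "h \<in> borel_measurable M" if "h \<in> borel_measurable borel" for h :: "'a \<Rightarrow> ennreal"
    using that borel_sets by (auto simp: measurable_def space_M)
  have "(\<integral>\<^sup>+x. epowr (\<rho> x) p \<partial>M) \<le> (\<integral>\<^sup>+x. (\<Sum>n. epowr (ennreal (real (Suc n)) * \<sigma> n x) p) \<partial>M)"
    unfolding \<rho>_def by (intro nn_integral_mono epowr_SUP_le_suminf p_pos)
  also have "\<dots> = (\<Sum>n. \<integral>\<^sup>+x. epowr (ennreal (real (Suc n)) * \<sigma> n x) p \<partial>M)"
    using M_meas[OF \<sigma>] by (intro nn_integral_suminf) measurable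
  also have "\<dots> \<le> (\<Sum>n. ennreal ((1/2) ^ n))"
  proof (intro suminf_le summableI)
    fix n
    let ?k = "ennreal (real (Suc n) powr p)"
    have "(\<integral>\<^sup>+x. epowr (ennreal (real (Suc n)) * \<sigma> n x) p \<partial>M)
        = (\<integral>\<^sup>+x. ?k * epowr (\<sigma> n x) p \<partial>M)"
      by (subst epowr_mult[OF p_pos, of "real (Suc n)", OF of_nat_0_less_iff[THEN iffD2, OF zero_less_Suc]]) (rule refl)
    also have "\<dots> = ?k * (\<integral>\<^sup>+x. epowr (\<sigma> n x) p \<partial>M)"
      using M_meas[OF \<sigma>] by (intro nn_integral_cmult measurable_compose[OF _ epowr_measurable])
    also have "(\<integral>\<^sup>+x. epowr (\<sigma> n x) p \<partial>M) \<le> (\<integral>\<^sup>+x. epowr (v n x) p + epowr (w n x) p \<partial>M)"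
      unfolding \<sigma>_def by (intro nn_integral_mono epowr_sup_le p_pos)
    also have "\<dots> = (\<integral>\<^sup>+x. epowr (v n x) p \<partial>M) + (\<integral>\<^sup>+x. epowr (w n x) p \<partial>M)"
      using M_meas[OF v(1)[of n]] M_meas[OF w(1)[of n]] by (intro nn_integral_add measurable_compose[OF _ epowr_measurable])
    also have "\<dots> \<le> ennreal (c n)"
      using fg(3)[of n] by (simp add: v(3) w(3))
    also have "?k * ennreal (c n) = ennreal ((1/2) ^ n)"
      by (subst ennreal_mult'[symmetric]) (simp_all add: c_def)
    finally show "(\<integral>\<^sup>+x. epowr (ennreal (real (Suc n)) * \<sigma> n x) p \<partial>M) \<le> ennreal ((1/2) ^ n)"
      by (simp add: mult_left_mono)
  qed
  also have "\<dots> = ennreal 2"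
    using geometric_sums[of "1/2 :: real"] by (intro suminf_ennreal_eq) auto
  also have "\<dots> < \<infinity>"
    by simp
  finally have \<rho>_fin: "(\<integral>\<^sup>+x. epowr (\<rho> x) p \<partial>M) < \<infinity>" .
  have "curve_integral \<rho> \<gamma> l = \<infinity>"
    if \<gamma>: "curve_in U \<gamma> l" and hit: "\<And>n. \<gamma> ` {0..l} \<inter> G n \<noteq> {}" for \<gamma> l
  proof -
    \<comment> \<open>The bound \<open>1/2\<close> is for the case of a large gradient integral,
      \<open>l/2\<close> for the case that the test function is at least \<open>1/2\<close> along
      the whole curve of length \<open>l\<close>.\<close>
    define d where "d = min (1/2) (l/2)"
    have l: "0 < l"
      using \<gamma> by (simp add: curve_in_def)
    then have d: "0 < d"
      by (simp add: d_def)
    have meas: "h \<in> borel_measurable (restrict_space borel U)"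
      if "h \<in> borel_measurable borel" for h :: "'a \<Rightarrow> ennreal"
      using that by (rule measurable_restrict_space1)
    have lower: "ennreal (real (Suc n) * d) \<le> curve_integral \<rho> \<gamma> l" for n
    proof -
      have "ennreal d \<le> curve_integral (\<sigma> n) \<gamma> l"
      proof (cases "ennreal (1/2) \<le> curve_integral (g n) \<gamma> l")
        case True
        have "ennreal d \<le> ennreal (1/2)"
          by (intro ennreal_leI) (simp add: d_def)
        also note True
        also have "curve_integral (g n) \<gamma> l \<le> curve_integral (\<sigma> n) \<gamma> l"
          using w(2) by (intro curve_integral_mono[OF \<gamma>]) (auto simp: \<sigma>_def intro: le_supI2)
        finally show ?thesis .
      next
        case False
        obtain s where s: "s \<in> {0..l}" "\<gamma> s \<in> G n"
          using hit[of n] by blast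
        have "ennreal (1/2) \<le> f n (\<gamma> t)" if "t \<in> {0..l}" for t
        proof (rule ccontr)
          assume "\<not> ?thesis"
          then have "f n (\<gamma> t) + curve_integral (g n) \<gamma> l < ennreal (1/2) + ennreal (1/2)"
            using False by (intro add_strict_mono) auto
          also have "\<dots> = 1"
            by (subst ennreal_plus[symmetric]) auto
          finally have "f n (\<gamma> t) + curve_integral (g n) \<gamma> l < 1" .
          moreover have "f n (\<gamma> s) \<le> f n (\<gamma> t) + curve_integral (g n) \<gamma> l"
            using capacity_pair_le[OF fg(1), of \<gamma> l s t n] \<gamma> s that by (simp add: spR)
          ultimately show False
            using fg(2)[OF s(2)] by simp
        qed
        moreover have "\<gamma> t \<in> U" if "t \<in> {0..l}" for t
          using \<gamma> that by (auto simp: curve_in_def)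
        ultimately have "ennreal (1/2) \<le> \<sigma> n (\<gamma> t)" if "t \<in> {0..l}" for t
          using v(2)[of "\<gamma> t" n] that unfolding \<sigma>_def by (meson le_supI1 order_trans)
        then have "(\<integral>\<^sup>+t. ennreal (1/2) * indicator {0..l} t \<partial>lborel) \<le> curve_integral (\<sigma> n) \<gamma> l"
          unfolding curve_integral_def by (intro nn_integral_mono) (auto simp: indicator_def)
        moreover have "(\<integral>\<^sup>+t. ennreal (1/2) * indicator {0..l} t \<partial>lborel) = ennreal (1/2 * l)"
          using l by (subst nn_integral_cmult_indicator, simp) (subst ennreal_mult', simp_all)
        moreover have "ennreal d \<le> ennreal (1/2 * l)"
          by (intro ennreal_leI) (simp add: d_def)
        ultimately show ?thesis
          by (metis order_trans)
      qed
      then have "ennreal (real (Suc n)) * ennreal d \<le> ennreal (real (Suc n)) * curve_integral (\<sigma> n) \<gamma> l"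
        by (intro mult_left_mono) auto
      also have "\<dots> = curve_integral (\<lambda>x. ennreal (real (Suc n)) * \<sigma> n x) \<gamma> l"
        using curve_integral_cmult[OF \<gamma> meas[OF \<sigma>]] by simp
      also have "\<dots> \<le> curve_integral \<rho> \<gamma> l"
        unfolding \<rho>_def by (intro curve_integral_mono[OF \<gamma>] SUP_upper) simp
      finally show ?thesis
        using d by (simp add: ennreal_mult')
    qed
    show ?thesis
    proof (cases "curve_integral \<rho> \<gamma> l")
      case (real r)
      obtain n :: nat where n: "r < real n * d"
        using reals_Archimedean3[OF d] by blast
      also have "real n * d \<le> real (Suc n) * d"
        using d by (intro mult_right_mono) auto
      finally have "curve_integral \<rho> \<gamma> l < ennreal (real (Suc n) * d)"
        unfolding real(2) using real(1) by (intro ennreal_lessI) auto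
      with lower[of n] show ?thesis
        by simp
    qed simp
  qed
  then have "curve_integral \<rho> \<gamma> l = \<infinity>"
    if "curve_in U \<gamma> l" "\<not> (\<exists>G. Q G \<and> \<gamma> ` {0..l} \<inter> G = {})" for \<gamma> l
    using that G(1) by meson
  then show ?thesis
    unfolding ae_curve_def exceptional_def using \<rho> \<rho>_fin
    by (intro bexI[of _ \<rho>] conjI) (auto intro: measurable_restrict_space1)
qed

text \<open>The set where the \<open>n\<close>-th test function equals 1 is measurable, contains
  \<open>E\<close>, and has measure at most the energy of the pair. The intersection of these sets
  is null, and completeness passes this to \<open>E\<close>.\<close>

lemma null_of_capacity_0:
  assumes U: "U \<in> sets M" and E: "E \<subseteq> U" "capacity p (restrict_space M U) E = 0"
  shows "E \<in> null_sets M"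
proof -
  let ?R = "restrict_space M U"
  have "\<exists>f g. capacity_pair ?R f g \<and> (\<forall>x\<in>E. f x = 1) \<and>
       (\<integral>\<^sup>+x. epowr (f x) p \<partial>?R) + (\<integral>\<^sup>+x. epowr (g x) p \<partial>?R) < ennreal (1 / real (Suc n))" for n
    using E(2) by (subst capacity_less_iff[OF p_pos, symmetric]) simp
  then obtain f g where fg: "\<And>n. capacity_pair ?R (f n) (g n)" "\<And>n x. x \<in> E \<Longrightarrow> f n x = 1"
    "\<And>n. (\<integral>\<^sup>+x. epowr (f n x) p \<partial>?R) + (\<integral>\<^sup>+x. epowr (g n x) p \<partial>?R) < ennreal (1 / real (Suc n))"
    by metis
  have U': "U \<inter> space M \<in> sets M"
    using U by (simp add: space_M)
  define A where "A n = {x \<in> space ?R. f n x = 1}" for n :: nat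
  have f: "f n \<in> borel_measurable ?R" for n
    using fg(1)[of n] by (simp add: capacity_pair_def)
  have A_R: "A n \<in> sets ?R" for n
    using f[of n] unfolding A_def by measurable
  then have A: "A n \<in> sets M" "A n \<subseteq> U" for n
    using sets_restrict_space_iff[OF U'] by blast+
  have le: "emeasure M (A n) \<le> ennreal (1 / real (Suc n))" for n
  proof -
    have "emeasure M (A n) = (\<integral>\<^sup>+x. indicator (A n) x \<partial>?R)"
      using A_R[of n] A[of n] U' by (simp add: emeasure_restrict_space)
    also have "\<dots> \<le> (\<integral>\<^sup>+x. epowr (f n x) p \<partial>?R)"
      by (intro nn_integral_mono) (auto simp: indicator_def A_def)
    also have "\<dots> \<le> (\<integral>\<^sup>+x. epowr (f n x) p \<partial>?R) + (\<integral>\<^sup>+x. epowr (g n x) p \<partial>?R)"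
      by simp
    finally show ?thesis
      using fg(3)[of n] by simp
  qed
  have "emeasure M (\<Inter>n. A n) \<le> ennreal \<epsilon>" if pos: "0 < \<epsilon>" for \<epsilon>
  proof -
    obtain n where n: "1 / real (Suc n) < \<epsilon>"
      by (rule nat_approx_posE[OF pos])
    have "emeasure M (\<Inter>n. A n) \<le> emeasure M (A n)"
      using A by (intro emeasure_mono) auto
    also have "\<dots> \<le> ennreal \<epsilon>"
      using le[of n] n by (meson ennreal_leI less_imp_le order_trans)
    finally show ?thesis .
  qed
  then have "emeasure M (\<Inter>n. A n) = 0"
    using ennreal_le_epsilon[of 0 "emeasure M (\<Inter>n. A n)"] by simp
  then have "(\<Inter>n. A n) \<in> null_sets M"
    using A by (auto simp: null_sets_def)
  moreover have "E \<subseteq> (\<Inter>n. A n)"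
    using fg(2) E(1) by (auto simp: A_def space_restrict_space space_M)
  ultimately show ?thesis
    by (rule null_subset)
qed

lemma ae_curve_misses_null:
  assumes "U \<in> sets M" "capacity p (restrict_space M U) E = 0"
  shows "ae_curve p M U (\<lambda>\<gamma> l. \<gamma> ` {0..l} \<inter> E = {})"
  using ae_curve_misses[OF assms(1), of "\<lambda>G. G = E"] assms(2) by simp

text \<open>The indicator of \<open>E\<close> has zero integral, and every positive multiple of
  \<open>\<rho>\<close> is a gradient for it: a curve either misses \<open>E\<close>, where the
  indicator vanishes, or has infinite integral. Small multiples make the energy arbitrarily
  small.\<close>

lemma capacity_0I:
  assumes E: "E \<in> null_sets M" and ae: "ae_curve p M UNIV (\<lambda>\<gamma> l. \<gamma> ` {0..l} \<inter> E = {})"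
  shows "capacity p M E = 0"
proof (rule capacity_eq_0I)
  fix \<epsilon> :: real
  assume \<epsilon>: "0 < \<epsilon>"
  obtain \<rho> where \<rho>: "\<rho> \<in> borel_measurable (restrict_space borel (space M))"
    "(\<integral>\<^sup>+x. epowr (\<rho> x) p \<partial>M) < \<infinity>"
    "\<And>\<gamma> l. curve_in UNIV \<gamma> l \<Longrightarrow> \<gamma> ` {0..l} \<inter> E \<noteq> {} \<Longrightarrow> curve_integral \<rho> \<gamma> l = \<infinity>"
    using ae by (auto simp: exceptional_def ae_curve_def)
  obtain r where r: "0 \<le> r" "(\<integral>\<^sup>+x. epowr (\<rho> x) p \<partial>M) = ennreal r"
    using \<rho>(2) by (auto simp: less_top_ennreal)
  \<comment> \<open>Chosen so that \<open>c powr p * r < \<epsilon>\<close>; the summand 1 avoids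
    division by zero when \<open>r = 0\<close>.\<close>
  define c where "c = (\<epsilon> / (2 * (r + 1))) powr (1 / p)"
  have c: "0 < c" "c powr p = \<epsilon> / (2 * (r + 1))"
    using \<epsilon> r(1) p_pos by (auto simp: c_def powr_powr)
  let ?f = "indicator E :: 'a \<Rightarrow> ennreal" and ?g = "\<lambda>x. ennreal c * \<rho> x"
  have \<rho>M: "\<rho> \<in> borel_measurable M"
    using \<rho>(1) measurable_mono[OF order_refl refl restrict_borel_sets', of borel]
    by (auto simp: space_restrict_space)
  have "capacity_pair M ?f ?g"
    unfolding capacity_pair_def
  proof (intro conjI allI impI)
    show "?f \<in> borel_measurable M"
      using E by (intro borel_measurable_indicator) auto
    show "?g \<in> borel_measurable (restrict_space borel (space M))"
      using \<rho>(1) by measurable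
    show "?f x \<le> 1" for x
      by (simp add: indicator_def)
    fix \<gamma> l
    assume \<gamma>: "curve_in (space M) \<gamma> l"
    have "?f (\<gamma> 0) = 0 \<and> ?f (\<gamma> l) = 0 \<or> curve_integral ?g \<gamma> l = \<infinity>"
    proof (cases "\<gamma> ` {0..l} \<inter> E = {}")
      case True
      moreover have "0 \<in> {0..l}" "l \<in> {0..l}"
        using \<gamma> by (auto simp: curve_in_def)
      ultimately have "\<gamma> 0 \<notin> E" "\<gamma> l \<notin> E"
        by blast+
      then show ?thesis
        by simp
    next
      case False
      then have "curve_integral \<rho> \<gamma> l = \<infinity>"
        using \<gamma> by (intro \<rho>(3)) (auto simp: space_M)
      then have "curve_integral ?g \<gamma> l = \<infinity>"
        using c(1) by (simp add: curve_integral_cmult[OF \<gamma> \<rho>(1)] ennreal_mult_top)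
      then show ?thesis ..
    qed
    then show "?f (\<gamma> 0) \<le> ?f (\<gamma> l) + curve_integral ?g \<gamma> l"
      "?f (\<gamma> l) \<le> ?f (\<gamma> 0) + curve_integral ?g \<gamma> l"
      by auto
  qed
  moreover have "(\<integral>\<^sup>+x. epowr (?f x) p \<partial>M) + (\<integral>\<^sup>+x. epowr (?g x) p \<partial>M) < ennreal \<epsilon>"
  proof -
    have "(\<integral>\<^sup>+x. epowr (?f x) p \<partial>M) = (\<integral>\<^sup>+x. ?f x \<partial>M)"
      by (intro nn_integral_cong) (simp add: indicator_def)
    also have "\<dots> = 0"
      using E by (simp add: null_sets_def)
    finally have f0: "(\<integral>\<^sup>+x. epowr (?f x) p \<partial>M) = 0" .
    have "(\<integral>\<^sup>+x. epowr (?g x) p \<partial>M) = (\<integral>\<^sup>+x. ennreal (c powr p) * epowr (\<rho> x) p \<partial>M)"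
      using c(1) p_pos by (simp add: epowr_mult)
    also have "\<dots> = ennreal (c powr p) * ennreal r"
      using \<rho>M by (subst nn_integral_cmult) (auto simp: r(2) intro: measurable_compose[OF _ epowr_measurable])
    also have "\<dots> = ennreal (c powr p * r)"
      by (rule ennreal_mult'[symmetric]) simp
    also have "c powr p * r < \<epsilon>"
    proof -
      have "\<epsilon> * r < \<epsilon> * (2 * (r + 1))"
        using \<epsilon> r(1) by (intro mult_strict_left_mono) auto
      then show ?thesis
        using r(1) by (simp add: c(2) divide_less_eq)
    qed
    then have "ennreal (c powr p * r) < ennreal \<epsilon>"
      using \<epsilon> by (intro ennreal_lessI)
    finally show ?thesis
      by (simp add: f0)
  qed
  ultimately show "capacity p M E < ennreal \<epsilon>"
    unfolding capacity_less_iff[OF p_pos]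
    by (intro exI[of _ ?f] exI[of _ ?g] conjI ballI) auto
qed

lemma capacity_0_null: "capacity p M E = 0 \<Longrightarrow> E \<in> null_sets M"
  using null_of_capacity_0[of UNIV E] sets.top[of M] by (simp add: restrict_UNIV space_M)

lemma capacity_0_ae_curve:
  "capacity p M E = 0 \<Longrightarrow> ae_curve p M UNIV (\<lambda>\<gamma> l. \<gamma> ` {0..l} \<inter> E = {})"
  using ae_curve_misses_null[of UNIV E] sets.top[of M] by (simp add: restrict_UNIV space_M)

lemma capacity_0_path_open: "capacity p M E = 0 \<Longrightarrow> path_open p M E"
  unfolding path_open_def
proof (rule ae_curve_mono[OF capacity_0_ae_curve])
  fix \<gamma> :: "real \<Rightarrow> 'a" and l
  assume "\<gamma> ` {0..l} \<inter> E = {}"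
  then have "{t \<in> {0..l}. \<gamma> t \<in> E} = {}"
    by blast
  then show "openin (top_of_set {0..l}) {t \<in> {0..l}. \<gamma> t \<in> E}"
    by (simp only: openin_empty)
qed auto

lemma ae_curve_UNIV_misses:
  assumes "\<And>\<epsilon>. 0 < \<epsilon> \<Longrightarrow> \<exists>G. Q G \<and> capacity p M G < ennreal \<epsilon>"
  shows "ae_curve p M UNIV (\<lambda>\<gamma> l. \<exists>G. Q G \<and> \<gamma> ` {0..l} \<inter> G = {})"
  using ae_curve_misses[of UNIV Q] assms sets.top[of M] by (simp add: restrict_UNIV space_M)

section \<open>Quasiopen sets\<close>

text \<open>Along a curve that misses \<open>G\<close>, the preimage of \<open>U\<close> is the
  preimage of the open set \<open>G \<union> U\<close>.\<close>

lemma quasiopen_path_open: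
  assumes "quasiopen p M U"
  shows "path_open p M U"
proof -
  have "ae_curve p M UNIV (\<lambda>\<gamma> l. \<exists>G. open (G \<union> U) \<and> \<gamma> ` {0..l} \<inter> G = {})"
    using assms by (intro ae_curve_UNIV_misses) (auto simp: quasiopen_def)
  then show ?thesis
    unfolding path_open_def
  proof (rule ae_curve_mono)
    fix \<gamma> l
    assume \<gamma>: "curve_in UNIV \<gamma> l" and "\<exists>G. open (G \<union> U) \<and> \<gamma> ` {0..l} \<inter> G = {}"
    then obtain G where G: "open (G \<union> U)" "\<gamma> ` {0..l} \<inter> G = {}"
      by blast
    have "openin (top_of_set {0..l}) ({0..l} \<inter> \<gamma> -` (G \<union> U))"
      using \<gamma> G(1) by (intro continuous_openin_preimage_gen) (auto simp: curve_in_def)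
    moreover have "{0..l} \<inter> \<gamma> -` (G \<union> U) = {t \<in> {0..l}. \<gamma> t \<in> U}"
      using G(2) by auto
    ultimately show "openin (top_of_set {0..l}) {t \<in> {0..l}. \<gamma> t \<in> U}"
      by simp
  qed simp
qed

text \<open>The hull is the intersection of open sets \<open>G n \<union> U\<close>, so its excess
  over \<open>U\<close> lies in every \<open>G n\<close>. These open covers are recorded besides the
  zero capacity, since they are needed to return from the hull to \<open>U\<close>.\<close>

lemma quasiopen_borel_hull:
  assumes "quasiopen p M U"
  obtains B where "B \<in> sets borel" "U \<subseteq> B" "capacity p M (B - U) = 0"
    "\<And>\<epsilon>. 0 < \<epsilon> \<Longrightarrow> \<exists>G. open G \<and> capacity p M G < ennreal \<epsilon> \<and> B - U \<subseteq> G"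
proof -
  have "\<exists>G. open G \<and> capacity p M G < ennreal (1 / real (Suc n)) \<and> open (G \<union> U)" for n
    using assms by (simp add: quasiopen_def)
  then obtain G where G: "\<And>n. open (G n)" "\<And>n. capacity p M (G n) < ennreal (1 / real (Suc n))"
    "\<And>n. open (G n \<union> U)"
    by metis
  let ?B = "\<Inter>n. G n \<union> U"
  have small: "\<exists>G. open G \<and> capacity p M G < ennreal \<epsilon> \<and> ?B - U \<subseteq> G" if pos: "0 < \<epsilon>" for \<epsilon>
  proof -
    obtain n where n: "1 / real (Suc n) < \<epsilon>"
      by (rule nat_approx_posE[OF pos])
    have "capacity p M (G n) < ennreal \<epsilon>"
      using G(2)[of n] n by (meson ennreal_leI less_imp_le less_le_trans)
    then show ?thesis
      using G(1) by (intro exI[of _ "G n"]) auto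
  qed
  have "capacity p M (?B - U) = 0"
    using small by (intro capacity_eq_0I) (meson capacity_mono le_less_trans)
  moreover have "?B \<in> sets borel"
    using G(3) by (intro sets.countable_INT) auto
  ultimately show ?thesis
    using small by (intro that[of ?B]) auto
qed

lemma quasiopen_sets:
  assumes "quasiopen p M U"
  shows "U \<in> sets M"
proof -
  obtain B where B: "B \<in> sets borel" "U \<subseteq> B" "capacity p M (B - U) = 0"
    using quasiopen_borel_hull[OF assms] by metis
  have "B - (B - U) \<in> sets M"
    by (rule sets.Diff[OF borel_sets[OF B(1)] null_setsD2[OF capacity_0_null[OF B(3)]]])
  also have "B - (B - U) = U"
    using B(2) by auto
  finally show ?thesis .
qed

text \<open>Intrinsic capacity zero says that almost every curve inside \<open>U\<close> misses
  \<open>E\<close>. Since \<open>U\<close> is \<open>p\<close>-path open, a curve of the whole space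
  that meets \<open>E\<close> typically does so on a subcurve inside \<open>U\<close>; hence almost
  every curve misses \<open>E\<close>, and \<open>capacity_0I\<close> applies.\<close>

lemma capacity_0_of_intrinsic:
  assumes U: "quasiopen p M U" and E: "E \<subseteq> U" "capacity p (restrict_space M U) E = 0"
  shows "capacity p M E = 0"
proof (rule capacity_0I)
  have U': "U \<in> sets M"
    using U by (rule quasiopen_sets)
  then show "E \<in> null_sets M"
    using E by (rule null_of_capacity_0)
  have "ae_curve p M UNIV (\<lambda>\<gamma> l. openin (top_of_set {0..l}) {t \<in> {0..l}. \<gamma> t \<in> U} \<and>
      (\<forall>a b. 0 \<le> a \<and> a < b \<and> b \<le> l \<and> \<gamma> ` {a..b} \<subseteq> U \<longrightarrow>
         (\<lambda>t. \<gamma> (a + t)) ` {0..b - a} \<inter> E = {}))"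
    using quasiopen_path_open[OF U] ae_curve_misses_null[OF U' E(2)]
    by (intro ae_curve_conj p_pos restrict_borel_sets' ae_curve_subcurves space_M)
      (auto simp: path_open_def space_M)
  then show "ae_curve p M UNIV (\<lambda>\<gamma> l. \<gamma> ` {0..l} \<inter> E = {})"
  proof (rule ae_curve_mono, elim conjE)
    fix \<gamma> l
    assume \<gamma>: "curve_in UNIV \<gamma> l" and op: "openin (top_of_set {0..l}) {t \<in> {0..l}. \<gamma> t \<in> U}"
      and sub: "\<forall>a b. 0 \<le> a \<and> a < b \<and> b \<le> l \<and> \<gamma> ` {a..b} \<subseteq> U \<longrightarrow>
         (\<lambda>t. \<gamma> (a + t)) ` {0..b - a} \<inter> E = {}"
    have False if t: "t \<in> {0..l}" "\<gamma> t \<in> E" for t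
    proof -
      have l: "0 < l" and tU: "t \<in> {t \<in> {0..l}. \<gamma> t \<in> U}"
        using \<gamma> t E(1) by (auto simp: curve_in_def)
      obtain a b \<delta> where ab: "0 \<le> a" "a < b" "b \<le> l" "t \<in> {a..b}"
        "{a..b} \<subseteq> {t \<in> {0..l}. \<gamma> t \<in> U}" "0 < \<delta>"
        "{a..b} \<inter> ball t \<delta> = {t \<in> {0..l}. \<gamma> t \<in> U} \<inter> ball t \<delta>"
        by (rule openin_Icc_nbhd[OF op l tU])
      have "\<gamma> ` {a..b} \<subseteq> U"
        using ab(5) by blast
      with ab(1-3) have "(\<lambda>t. \<gamma> (a + t)) ` {0..b - a} \<inter> E = {}"
        using sub by blast
      moreover have "\<gamma> (a + (t - a)) \<in> (\<lambda>t. \<gamma> (a + t)) ` {0..b - a}"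
        using ab(4) by (intro imageI) auto
      ultimately show False
        using t(2) by auto
    qed
    then show "\<gamma> ` {0..l} \<inter> E = {}"
      by blast
  qed simp
qed

section \<open>From quasicontinuity to continuity along curves\<close>

text \<open>The infinite values occur only inside each exceptional open set \<open>G\<close>, and a
  curve that misses \<open>G\<close> sees \<open>u\<close> only on \<open>U - G\<close>, where it is
  continuous.\<close>

lemma quasicontinuous_imp:
  assumes "quasicontinuous p M U u"
  shows "finite_qe p M U u"
    and "ae_curve p M UNIV (\<lambda>\<gamma> l. continuous_on {t\<in>{0..l}. \<gamma> t \<in> U} (u \<circ> \<gamma>))"
proof -
  show "finite_qe p M U u"
    unfolding finite_qe_def
  proof (rule capacity_eq_0I)
    fix \<epsilon> :: real
    assume "0 < \<epsilon>"
    then obtain G where G: "capacity p M G < ennreal \<epsilon>" "\<forall>x\<in>U - G. \<bar>u x\<bar> \<noteq> \<infinity>"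
      using assms by (auto simp: quasicontinuous_def)
    have "{x\<in>U. \<bar>u x\<bar> = \<infinity>} \<subseteq> G"
    proof
      fix x
      assume "x \<in> {x\<in>U. \<bar>u x\<bar> = \<infinity>}"
      then show "x \<in> G"
        using bspec[OF G(2), of x] by (cases "x \<in> G") auto
    qed
    then show "capacity p M {x\<in>U. \<bar>u x\<bar> = \<infinity>} < ennreal \<epsilon>"
      using G(1) capacity_mono le_less_trans by blast
  qed
  have "ae_curve p M UNIV (\<lambda>\<gamma> l. \<exists>G. continuous_on (U - G) u \<and> \<gamma> ` {0..l} \<inter> G = {})"
    using assms unfolding quasicontinuous_def by (intro ae_curve_UNIV_misses) blast
  then show "ae_curve p M UNIV (\<lambda>\<gamma> l. continuous_on {t\<in>{0..l}. \<gamma> t \<in> U} (u \<circ> \<gamma>))"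
  proof (rule ae_curve_mono)
    fix \<gamma> l
    assume \<gamma>: "curve_in UNIV \<gamma> l" and "\<exists>G. continuous_on (U - G) u \<and> \<gamma> ` {0..l} \<inter> G = {}"
    then obtain G where G: "continuous_on (U - G) u" "\<gamma> ` {0..l} \<inter> G = {}"
      by blast
    have "continuous_on {t\<in>{0..l}. \<gamma> t \<in> U} \<gamma>"
      using \<gamma> unfolding curve_in_def by (auto intro: continuous_on_subset)
    moreover have "continuous_on (\<gamma> ` {t\<in>{0..l}. \<gamma> t \<in> U}) u"
      using G(2) by (intro continuous_on_subset[OF G(1)]) blast
    ultimately show "continuous_on {t\<in>{0..l}. \<gamma> t \<in> U} (u \<circ> \<gamma>)"
      by (rule continuous_on_compose)
  qed simp
qed

text \<open>A test pair for the whole space restricts to \<open>U\<close>: there are fewer curves to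
  check, and the integrals do not grow. The argument is by contradiction because test pairs
  characterize strict bounds.\<close>

lemma capacity_restrict_le:
  assumes U: "U \<in> sets M"
  shows "capacity p (restrict_space M U) (G \<inter> U) \<le> capacity p M G"
proof (rule ccontr)
  assume "\<not> ?thesis"
  then have "capacity p M G < capacity p (restrict_space M U) (G \<inter> U)"
    by simp
  then obtain f g where fg: "capacity_pair M f g" "\<And>x. x \<in> G \<Longrightarrow> f x = 1"
    "(\<integral>\<^sup>+x. epowr (f x) p \<partial>M) + (\<integral>\<^sup>+x. epowr (g x) p \<partial>M) < capacity p (restrict_space M U) (G \<inter> U)"
    unfolding capacity_less_iff[OF p_pos] by blast
  have spR: "space (restrict_space M U) = U"
    by (simp add: space_restrict_space space_M)
  have U': "U \<inter> space M \<in> sets M"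
    using U by (simp add: space_M)
  have "capacity_pair (restrict_space M U) f g"
    using fg(1) curve_in_mono[of U _ _ UNIV]
    by (auto simp: capacity_pair_def spR space_M intro: measurable_restrict_space1)
  moreover have le: "(\<integral>\<^sup>+x. h x \<partial>restrict_space M U) \<le> (\<integral>\<^sup>+x. h x \<partial>M)" for h
    unfolding nn_integral_restrict_space[OF U']
    by (intro nn_integral_mono) (simp add: indicator_def)
  have "(\<integral>\<^sup>+x. epowr (f x) p \<partial>restrict_space M U) + (\<integral>\<^sup>+x. epowr (g x) p \<partial>restrict_space M U)
      < capacity p (restrict_space M U) (G \<inter> U)"
    by (rule le_less_trans[OF add_mono[OF le le] fg(3)])
  ultimately have "capacity p (restrict_space M U) (G \<inter> U) < capacity p (restrict_space M U) (G \<inter> U)"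
    using fg(2) by (subst capacity_less_iff[OF p_pos]) blast
  then show False
    by simp
qed

lemma quasicontinuous_imp_intrinsic:
  assumes "quasicontinuous p M U u" "U \<in> sets M"
  shows "intrinsic_quasicontinuous p M U u"
  unfolding intrinsic_quasicontinuous_def
proof (intro allI impI)
  fix \<epsilon> :: real
  assume "0 < \<epsilon>"
  then obtain G where G: "open G" "capacity p M G < ennreal \<epsilon>"
    "\<forall>x\<in>U - G. \<bar>u x\<bar> \<noteq> \<infinity>" "continuous_on (U - G) u"
    using assms(1) by (auto simp: quasicontinuous_def)
  have "U - G \<inter> U = U - G"
    by blast
  moreover have "openin (top_of_set U) (G \<inter> U)"
    using G(1) by (auto simp: openin_open)
  ultimately show "\<exists>G. openin (top_of_set U) G \<and> capacity p (restrict_space M U) G < ennreal \<epsilon> \<and>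
        (\<forall>x\<in>U - G. \<bar>u x\<bar> \<noteq> \<infinity>) \<and> continuous_on (U - G) u"
    using G le_less_trans[OF capacity_restrict_le[OF assms(2)] G(2)]
    by (intro exI[of _ "G \<inter> U"]) simp
qed

text \<open>The exceptional sets are small only in the intrinsic sense, so continuity is obtained
  for curves inside \<open>U\<close>, and finiteness q.e. first intrinsically and then by
  \<open>capacity_0_of_intrinsic\<close>.\<close>

lemma intrinsic_quasicontinuous_imp:
  assumes "intrinsic_quasicontinuous p M U u" "quasiopen p M U"
  shows "finite_qe p M U u"
    and "ae_curve p M U (\<lambda>\<gamma> l. continuous_on {0..l} (u \<circ> \<gamma>))"
proof -
  have U: "U \<in> sets M"
    using assms(2) by (rule quasiopen_sets)
  have "capacity p (restrict_space M U) {x\<in>U. \<bar>u x\<bar> = \<infinity>} = 0"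
  proof (rule capacity_eq_0I)
    fix \<epsilon> :: real
    assume "0 < \<epsilon>"
    then obtain G where G: "capacity p (restrict_space M U) G < ennreal \<epsilon>" "\<forall>x\<in>U - G. \<bar>u x\<bar> \<noteq> \<infinity>"
      using assms(1) by (auto simp: intrinsic_quasicontinuous_def)
    have "{x\<in>U. \<bar>u x\<bar> = \<infinity>} \<subseteq> G"
    proof
      fix x
      assume "x \<in> {x\<in>U. \<bar>u x\<bar> = \<infinity>}"
      then show "x \<in> G"
        using bspec[OF G(2), of x] by (cases "x \<in> G") auto
    qed
    then show "capacity p (restrict_space M U) {x\<in>U. \<bar>u x\<bar> = \<infinity>} < ennreal \<epsilon>"
      using G(1) capacity_mono le_less_trans by blast
  qed
  then show "finite_qe p M U u"
    unfolding finite_qe_def by (intro capacity_0_of_intrinsic[OF assms(2)]) auto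
  have "ae_curve p M U (\<lambda>\<gamma> l. \<exists>G. continuous_on (U - G) u \<and> \<gamma> ` {0..l} \<inter> G = {})"
    using assms(1) unfolding intrinsic_quasicontinuous_def by (intro ae_curve_misses[OF U]) blast
  then show "ae_curve p M U (\<lambda>\<gamma> l. continuous_on {0..l} (u \<circ> \<gamma>))"
  proof (rule ae_curve_mono)
    fix \<gamma> l
    assume \<gamma>: "curve_in U \<gamma> l" and "\<exists>G. continuous_on (U - G) u \<and> \<gamma> ` {0..l} \<inter> G = {}"
    then obtain G where G: "continuous_on (U - G) u" "\<gamma> ` {0..l} \<inter> G = {}"
      by blast
    have "continuous_on (\<gamma> ` {0..l}) u"
      using \<gamma> G(2) by (intro continuous_on_subset[OF G(1)]) (auto simp: curve_in_def)
    then show "continuous_on {0..l} (u \<circ> \<gamma>)"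
      using \<gamma> by (intro continuous_on_compose) (auto simp: curve_in_def)
  qed simp
qed

section \<open>From curves inside \<open>U\<close> to arbitrary curves\<close>

text \<open>Continuity is local, and for almost every curve each parameter in the preimage of
  \<open>U\<close> has a neighbourhood on which the curve is a subcurve inside
  \<open>U\<close>.\<close>

lemma ae_curve_continuous_extend:
  assumes "quasiopen p M U"
    and "ae_curve p M U (\<lambda>\<gamma> l. continuous_on {0..l} (u \<circ> \<gamma>))"
  shows "ae_curve p M UNIV (\<lambda>\<gamma> l. continuous_on {t\<in>{0..l}. \<gamma> t \<in> U} (u \<circ> \<gamma>))"
proof -
  have "ae_curve p M UNIV (\<lambda>\<gamma> l. openin (top_of_set {0..l}) {t \<in> {0..l}. \<gamma> t \<in> U} \<and>
      (\<forall>a b. 0 \<le> a \<and> a < b \<and> b \<le> l \<and> \<gamma> ` {a..b} \<subseteq> U \<longrightarrow>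
         continuous_on {0..b - a} (u \<circ> (\<lambda>t. \<gamma> (a + t)))))"
    using quasiopen_path_open[OF assms(1)] assms(2)
    by (intro ae_curve_conj p_pos restrict_borel_sets' ae_curve_subcurves space_M)
      (auto simp: path_open_def space_M)
  then show ?thesis
  proof (rule ae_curve_mono, elim conjE)
    fix \<gamma> :: "real \<Rightarrow> 'a" and l
    let ?T = "{t \<in> {0..l}. \<gamma> t \<in> U}"
    assume \<gamma>: "curve_in UNIV \<gamma> l" and op: "openin (top_of_set {0..l}) ?T"
      and sub: "\<forall>a b. 0 \<le> a \<and> a < b \<and> b \<le> l \<and> \<gamma> ` {a..b} \<subseteq> U \<longrightarrow>
         continuous_on {0..b - a} (u \<circ> (\<lambda>t. \<gamma> (a + t)))"
    have l: "0 < l"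
      using \<gamma> by (simp add: curve_in_def)
    show "continuous_on ?T (u \<circ> \<gamma>)"
      unfolding continuous_on_eq_continuous_within
    proof
      fix t
      assume t: "t \<in> ?T"
      obtain a b \<delta> where ab: "0 \<le> a" "a < b" "b \<le> l" "t \<in> {a..b}" "{a..b} \<subseteq> ?T"
        "0 < \<delta>" "{a..b} \<inter> ball t \<delta> = ?T \<inter> ball t \<delta>"
        by (rule openin_Icc_nbhd[OF op l t])
      have "\<gamma> ` {a..b} \<subseteq> U"
        using ab(5) by blast
      with ab(1-3) have "continuous_on {0..b - a} (u \<circ> (\<lambda>t. \<gamma> (a + t)))"
        using sub by blast
      then have "continuous_on {a..b} (\<lambda>s. (u \<circ> (\<lambda>t. \<gamma> (a + t))) (s - a))"
        by (rule continuous_on_compose2) (auto intro: continuous_intros)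
      then have "continuous_on {a..b} (u \<circ> \<gamma>)"
        by (simp add: comp_def)
      then have "continuous (at t within {a..b}) (u \<circ> \<gamma>)"
        using ab(4) unfolding continuous_on_eq_continuous_within by blast
      \<comment> \<open>The interval and the parameter set coincide near \<open>t\<close>, so the
        limits at \<open>t\<close> are the same.\<close>
      moreover have "at t within {a..b} = at t within ?T"
        using ab(6,7) by (intro at_within_nhd[of t "ball t \<delta>"]) auto
      ultimately show "continuous (at t within ?T) (u \<circ> \<gamma>)"
        by simp
    qed
  qed simp
qed

section \<open>From continuity along curves to quasicontinuity\<close>

text \<open>The hypothesis \<open>Q\<close> concerns Borel sets, so it is applied to
  \<open>A \<inter> B\<close> with the Borel hull \<open>B\<close> of \<open>U\<close>. Almost every
  curve misses \<open>B - U\<close>, hence does not distinguish \<open>A \<inter> B\<close> from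
  \<open>A \<inter> U\<close>.\<close>

lemma path_open_Int_quasiopen:
  assumes Q: "\<And>V. V \<in> sets borel \<Longrightarrow> path_open p M V \<Longrightarrow> quasiopen p M V"
    and U: "quasiopen p M U" and A: "A \<in> sets borel" "path_open p M (A \<inter> U)"
  shows "quasiopen p M (A \<inter> U)"
proof -
  obtain B where B: "B \<in> sets borel" "U \<subseteq> B" "capacity p M (B - U) = 0"
    "\<And>\<epsilon>. 0 < \<epsilon> \<Longrightarrow> \<exists>G. open G \<and> capacity p M G < ennreal \<epsilon> \<and> B - U \<subseteq> G"
    using quasiopen_borel_hull[OF U] by metis
  have "ae_curve p M UNIV (\<lambda>\<gamma> l. openin (top_of_set {0..l}) {t\<in>{0..l}. \<gamma> t \<in> A \<inter> U} \<and>
      \<gamma> ` {0..l} \<inter> (B - U) = {})"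
    using A(2) capacity_0_ae_curve[OF B(3)]
    by (intro ae_curve_conj p_pos restrict_borel_sets') (auto simp: path_open_def space_M)
  then have "path_open p M (A \<inter> B)"
    unfolding path_open_def
  proof (rule ae_curve_mono, elim conjE)
    fix \<gamma> :: "real \<Rightarrow> 'a" and l
    assume "openin (top_of_set {0..l}) {t\<in>{0..l}. \<gamma> t \<in> A \<inter> U}" "\<gamma> ` {0..l} \<inter> (B - U) = {}"
    moreover from this(2) have "{t\<in>{0..l}. \<gamma> t \<in> A \<inter> B} = {t\<in>{0..l}. \<gamma> t \<in> A \<inter> U}"
      using B(2) by blast
    ultimately show "openin (top_of_set {0..l}) {t\<in>{0..l}. \<gamma> t \<in> A \<inter> B}"
      by (simp only:)
  qed simp
  then have AB: "quasiopen p M (A \<inter> B)"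
    using A(1) B(1) by (intro Q) auto
  show ?thesis
    unfolding quasiopen_def
  proof (intro allI impI)
    fix \<epsilon> :: real
    assume "0 < \<epsilon>"
    then have \<epsilon>: "0 < \<epsilon> / 8"
      by simp
    obtain G where G: "open G" "capacity p M G < ennreal (\<epsilon> / 8)" "open (G \<union> A \<inter> B)"
      using AB \<epsilon> unfolding quasiopen_def by blast
    obtain H where H: "open H" "capacity p M H < ennreal (\<epsilon> / 8)" "B - U \<subseteq> H"
      using B(4)[OF \<epsilon>] by blast
    have "capacity p M (G \<union> H) < ennreal \<epsilon>"
      using \<epsilon> G(2) H(2) by (intro capacity_Un_less p_pos restrict_borel_sets') auto
    \<comment> \<open>The open set \<open>H\<close> swallows \<open>B - U\<close>, so adding it
      makes the hull and \<open>U\<close> interchangeable.\<close>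
    moreover have "G \<union> H \<union> A \<inter> U = G \<union> A \<inter> B \<union> H"
      using B(2) H(3) by blast
    then have "open (G \<union> H \<union> A \<inter> U)"
      using G(3) H(1) by (simp only: open_Un)
    ultimately show "\<exists>G. open G \<and> capacity p M G < ennreal \<epsilon> \<and> open (G \<union> A \<inter> U)"
      using G(1) H(1) by (intro exI[of _ "G \<union> H"]) auto
  qed
qed

text \<open>Preimages of basic open sets and the set of infinite values are Borel traces on
  \<open>U\<close> and \<open>p\<close>-path open, hence quasiopen. Countably many exceptional open
  sets are then discarded together.\<close>

lemma quasicontinuousI:
  assumes Q: "\<And>V. V \<in> sets borel \<Longrightarrow> path_open p M V \<Longrightarrow> quasiopen p M V"
    and U: "quasiopen p M U" and u: "u \<in> borel_measurable (restrict_space borel U)"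
    and fin: "finite_qe p M U u"
    and cont: "ae_curve p M UNIV (\<lambda>\<gamma> l. continuous_on {t\<in>{0..l}. \<gamma> t \<in> U} (u \<circ> \<gamma>))"
  shows "quasicontinuous p M U u"
proof -
  have borel_preimage: "\<exists>A\<in>sets borel. {x\<in>U. u x \<in> S} = A \<inter> U" if "S \<in> sets borel" for S
  proof -
    have "u -` S \<inter> space (restrict_space borel U) \<in> sets (restrict_space borel U)"
      using u that by (rule measurable_sets)
    then obtain A where "A \<in> sets borel" "u -` S \<inter> U = U \<inter> A"
      by (auto simp: sets_restrict_space space_restrict_space)
    then show ?thesis
      by (intro bexI[of _ A]) auto
  qed
  have op: "ae_curve p M UNIV (\<lambda>\<gamma> l. openin (top_of_set {0..l}) {t\<in>{0..l}. \<gamma> t \<in> U} \<and>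
      continuous_on {t\<in>{0..l}. \<gamma> t \<in> U} (u \<circ> \<gamma>))"
    using cont quasiopen_path_open[OF U]
    by (intro ae_curve_conj p_pos restrict_borel_sets') (auto simp: path_open_def space_M)
  have quasiopen_preimage: "quasiopen p M {x\<in>U. u x \<in> S}" if S: "open S" for S
  proof -
    have "path_open p M {x\<in>U. u x \<in> S}"
      unfolding path_open_def
    proof (rule ae_curve_mono[OF op], elim conjE)
      fix \<gamma> :: "real \<Rightarrow> 'a" and l
      let ?T = "{t\<in>{0..l}. \<gamma> t \<in> U}"
      assume "openin (top_of_set {0..l}) ?T" "continuous_on ?T (u \<circ> \<gamma>)"
      \<comment> \<open>The preimage is open relative to \<open>?T\<close>, and \<open>?T\<close> is
        open relative to \<open>{0..l}\<close>.\<close>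
      then have "openin (top_of_set {0..l}) (?T \<inter> (u \<circ> \<gamma>) -` S)"
        using S by (meson continuous_openin_preimage_gen openin_trans)
      also have "?T \<inter> (u \<circ> \<gamma>) -` S = {t\<in>{0..l}. \<gamma> t \<in> {x\<in>U. u x \<in> S}}"
        by auto
      finally show "openin (top_of_set {0..l}) {t\<in>{0..l}. \<gamma> t \<in> {x\<in>U. u x \<in> S}}" .
    qed simp
    then show ?thesis
      using borel_preimage[of S] S path_open_Int_quasiopen[OF Q U] by auto
  qed
  let ?E = "{x\<in>U. \<bar>u x\<bar> = \<infinity>}"
  have E0: "capacity p M ?E = 0"
    using fin by (simp add: finite_qe_def)
  have "?E = {x\<in>U. u x \<in> {\<infinity>, -\<infinity>}}"
    by auto
  then have "quasiopen p M ?E"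
    using borel_preimage[of "{\<infinity>, -\<infinity>}"] capacity_0_path_open[OF E0] path_open_Int_quasiopen[OF Q U]
    by auto
  then have E: "\<exists>G. open G \<and> capacity p M G < ennreal \<epsilon> \<and> ?E \<subseteq> G" if "0 < \<epsilon>" for \<epsilon>
  proof -
    have \<epsilon>: "0 < \<epsilon> / 8"
      using that by simp
    obtain G where G: "capacity p M G < ennreal (\<epsilon> / 8)" "open (G \<union> ?E)"
      using \<open>quasiopen p M ?E\<close> \<epsilon> unfolding quasiopen_def by blast
    \<comment> \<open>The open set \<open>G \<union> ?E\<close> is itself the small neighbourhood
      sought: adding a set of capacity zero keeps the capacity small.\<close>
    have "capacity p M (G \<union> ?E) < ennreal \<epsilon>"
      using \<epsilon> G(1) E0 that by (intro capacity_Un_less p_pos restrict_borel_sets') auto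
    then show ?thesis
      using G(2) by blast
  qed
  obtain \<B> :: "ereal set set" where \<B>: "countable \<B>" "topological_basis \<B>"
    using ex_countable_basis by blast
  have "\<B> \<noteq> {}"
    using \<B>(2) topological_basisE[of \<B> UNIV] by auto
  define S where "S = from_nat_into \<B>"
  have S: "range S = \<B>"
    unfolding S_def using \<open>\<B> \<noteq> {}\<close> \<B>(1) by (rule range_from_nat_into)
  have S_open: "open (S n)" for n
    using S \<B>(2) topological_basis_open by blast
  show ?thesis
    unfolding quasicontinuous_def
  proof (intro allI impI)
    fix \<epsilon> :: real
    assume \<epsilon>: "0 < \<epsilon>"
    \<comment> \<open>The total for the sets \<open>G n\<close> stays below
      \<open>\<epsilon> / 8\<close>, as required for the union with \<open>H\<close>.\<close>
    have "\<exists>G. open G \<and> capacity p M G < ennreal ((\<epsilon> / 8) * (1/2) ^ Suc (Suc n)) \<and>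
        open (G \<union> {x\<in>U. u x \<in> S n})" for n
      using quasiopen_preimage[OF S_open[of n]] \<epsilon> unfolding quasiopen_def by simp
    then obtain G where G: "\<And>n. open (G n)"
      "\<And>n. capacity p M (G n) < ennreal ((\<epsilon> / 8) * (1/2) ^ Suc (Suc n))"
      "\<And>n. open (G n \<union> {x\<in>U. u x \<in> S n})"
      by metis
    obtain H where H: "open H" "capacity p M H < ennreal (\<epsilon> / 8)" "?E \<subseteq> H"
      using E[of "\<epsilon> / 8"] \<epsilon> by auto
    let ?G = "(\<Union>n. G n) \<union> H"
    have "capacity p M (\<Union>n. G n) < ennreal (\<epsilon> / 8)"
      using \<epsilon> G(2) by (intro capacity_UN_less p_pos restrict_borel_sets') auto
    then have "capacity p M ?G < ennreal \<epsilon>"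
      using \<epsilon> H(2) by (intro capacity_Un_less p_pos restrict_borel_sets')
    moreover have "open ?G"
      using G(1) H(1) by auto
    moreover have "\<forall>x\<in>U - ?G. \<bar>u x\<bar> \<noteq> \<infinity>"
      using H(3) by auto
    moreover have "continuous_on (U - ?G) u"
      unfolding continuous_on_open_invariant
    proof (intro allI impI)
      fix V :: "ereal set"
      assume V: "open V"
      \<comment> \<open>Off \<open>?G\<close> the added sets \<open>G n\<close> disappear, and what
        is left of this open set is the union of the preimages of the basic sets contained in
        \<open>V\<close>, that is, the preimage of \<open>V\<close>.\<close>
      let ?A = "\<Union>n\<in>{n. S n \<subseteq> V}. G n \<union> {x\<in>U. u x \<in> S n}"
      have "\<exists>n. u x \<in> S n \<and> S n \<subseteq> V" if "u x \<in> V" for x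
        using topological_basisE[OF \<B>(2) V that] S by (metis imageE)
      then have "?A \<inter> (U - ?G) = u -` V \<inter> (U - ?G)"
        by blast
      moreover have "open ?A"
        using G(3) by blast
      ultimately show "\<exists>A. open A \<and> A \<inter> (U - ?G) = u -` V \<inter> (U - ?G)"
        by blast
    qed
    ultimately show "\<exists>G. open G \<and> capacity p M G < ennreal \<epsilon> \<and>
        (\<forall>x\<in>U - G. \<bar>u x\<bar> \<noteq> \<infinity>) \<and> continuous_on (U - G) u"
      by blast
  qed
qed

end

theorem proposition5p1:
  fixes p :: real and M :: "'a::metric_space measure"
    and U :: "'a set" and u :: "'a \<Rightarrow> ereal"
  assumes "1 \<le> p"
    and "metric_measure_space M"
    and "locally_compact_space (euclidean :: 'a topology)"
    and "\<And>V. V \<in> sets borel \<Longrightarrow> path_open p M V \<Longrightarrow> quasiopen p M V"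
    and "quasiopen p M U"
    and "u \<in> borel_measurable (restrict_space borel U)"
  shows "(quasicontinuous p M U u \<longleftrightarrow>
            finite_qe p M U u \<and>
            ae_curve p M UNIV (\<lambda>\<gamma> l. continuous_on {t\<in>{0..l}. \<gamma> t \<in> U} (u \<circ> \<gamma>))) \<and>
         (intrinsic_quasicontinuous p M U u \<longleftrightarrow>
            finite_qe p M U u \<and>
            ae_curve p M UNIV (\<lambda>\<gamma> l. continuous_on {t\<in>{0..l}. \<gamma> t \<in> U} (u \<circ> \<gamma>))) \<and>
         (quasicontinuous p M U u \<longleftrightarrow>
            finite_qe p M U u \<and>
            ae_curve p M U (\<lambda>\<gamma> l. continuous_on {0..l} (u \<circ> \<gamma>)))"
proof -
  interpret complete_borel_space M p
    using assms(1,2) by unfold_locales (auto simp: metric_measure_space_def)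
  let ?b = "ae_curve p M UNIV (\<lambda>\<gamma> l. continuous_on {t\<in>{0..l}. \<gamma> t \<in> U} (u \<circ> \<gamma>))"
  let ?c = "ae_curve p M U (\<lambda>\<gamma> l. continuous_on {0..l} (u \<circ> \<gamma>))"
  have ba: "quasicontinuous p M U u" if "finite_qe p M U u" ?b
    using assms(4-6) that by (rule quasicontinuousI)
  have cb: ?b if ?c
    using assms(5) that by (rule ae_curve_continuous_extend)
  have bc: ?c if ?b
    using that
  proof (rule ae_curve_mono)
    fix \<gamma> l
    assume "curve_in U \<gamma> l" "continuous_on {t\<in>{0..l}. \<gamma> t \<in> U} (u \<circ> \<gamma>)"
    moreover from this(1) have "{t\<in>{0..l}. \<gamma> t \<in> U} = {0..l}"
      by (auto simp: curve_in_def)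
    ultimately show "continuous_on {0..l} (u \<circ> \<gamma>)"
      by simp
  qed simp
  \<comment> \<open>Quasicontinuity gives intrinsic quasicontinuity, which gives finiteness q.e. and
    continuity along curves in \<open>U\<close>, then along all curves, and from there
    quasicontinuity again.\<close>
  show ?thesis
    using ba bc cb quasicontinuous_imp quasicontinuous_imp_intrinsic[OF _ quasiopen_sets[OF assms(5)]]
      intrinsic_quasicontinuous_imp[OF _ assms(5)]
    by blast
qed

end
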